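(* Let $d:\mathbb Z\to\mathbb Z$ be an anti-symmetric function with $d(1)=1$. The group $G_d$ is conjugacy separable if and only if $d \bmod q$ is periodic for every positive integer $q$.
   Context: Anti-symmetric means $d(-i)=-d(i)$ for all $i\in\mathbb Z$. $G_d$ is the group with generators $t$, $a_i$, $c_i$ ($i\in\mathbb Z$) and relations, for all $i,j\in\mathbb Z$: $ta_it^{-1}=a_{i+1}$, $tc_it^{-1}=c_i$, $[a_i,a_j]=c_{i-j}$, $[c_i,a_j]=[c_i,c_j]=1$, $c_i=c_1^{d(i)}$, where $[x,y]=xyx^{-1}y^{-1}$. "$d\bmod q$ is periodic" means there is an integer $I\ge1$ with $d(n+I)\equiv d(n)\pmod q$ for all $n\in\mathbb Z$. A group is conjugacy separable if any two non-conjugate elements have non-conjugate images in some finite quotient. *)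

theory Defs
  imports "HOL-Algebra.Coset" "HOL-Number_Theory.Cong"
begin

section \<open>Groups given by generators and relations\<close>

text \<open>A letter \<open>(x, True)\<close> stands for the generator \<open>x\<close>, and \<open>(x, False)\<close> for its formal inverse.\<close>

type_synonym 'g gword = "('g \<times> bool) list"

definition gen_word :: "'g \<Rightarrow> 'g gword" where
  "gen_word x = [(x, True)]"

definition inv_word :: "'g gword \<Rightarrow> 'g gword" where
  "inv_word w = rev (map (\<lambda>(x, b). (x, \<not> b)) w)"

definition pow_word :: "'g gword \<Rightarrow> int \<Rightarrow> 'g gword" where
  "pow_word w n =
     (if n \<ge> 0 then concat (replicate (nat n) w)
      else concat (replicate (nat (- n)) (inv_word w)))"

definition comm_word :: "'g gword \<Rightarrow> 'g gword \<Rightarrow> 'g gword" where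
  "comm_word u v = u @ v @ inv_word u @ inv_word v"

text \<open>A pair \<open>(r, s) \<in> R\<close> is the defining relation \<open>r = s\<close>; two words are equivalent
  if they represent the same element of \<open>\<langle>generators | R\<rangle>\<close>.\<close>

inductive word_equiv :: "('g gword \<times> 'g gword) set \<Rightarrow> 'g gword \<Rightarrow> 'g gword \<Rightarrow> bool"
  for R where
  refl: "word_equiv R u u"
| sym: "word_equiv R u v \<Longrightarrow> word_equiv R v u"
| trans: "word_equiv R u v \<Longrightarrow> word_equiv R v w \<Longrightarrow> word_equiv R u w"
| cancel: "word_equiv R (u @ [(x, b), (x, \<not> b)] @ v) (u @ v)"
| relation: "(r, s) \<in> R \<Longrightarrow> word_equiv R (u @ r @ v) (u @ s @ v)"

definition word_class :: "('g gword \<times> 'g gword) set \<Rightarrow> 'g gword \<Rightarrow> 'g gword set" where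
  "word_class R u = {v. word_equiv R u v}"

text \<open>The generators are all elements of the type \<open>'g\<close>.\<close>

definition presented_group :: "('g gword \<times> 'g gword) set \<Rightarrow> 'g gword set monoid" where
  "presented_group R =
     \<lparr>carrier = range (word_class R),
      monoid.mult = (\<lambda>A B. \<Union>u\<in>A. \<Union>v\<in>B. word_class R (u @ v)),
      one = word_class R []\<rparr>"

lemma word_equiv_append:
  assumes "word_equiv R u u'" "word_equiv R v v'"
  shows "word_equiv R (u @ v) (u' @ v')"
proof -
  have left: "word_equiv R (w @ u) (w @ u')" if "word_equiv R u u'" for u u' w
    using that
  proof induction
    case (refl u)
    show ?case by (rule word_equiv.refl)
  next
    case (sym u v)
    from sym.IH show ?case by (rule word_equiv.sym)
  next
    case (trans u v w')
    from trans.IH show ?case by (rule word_equiv.trans)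
  next
    case (cancel u x b v)
    then show ?case using word_equiv.cancel[of R "w @ u" x b v] by simp
  next
    case (relation r s u v)
    then show ?case using word_equiv.relation[of r s R "w @ u" v] by simp
  qed
  have right: "word_equiv R (u @ w) (u' @ w)" if "word_equiv R u u'" for u u' w
    using that
  proof induction
    case (refl u)
    show ?case by (rule word_equiv.refl)
  next
    case (sym u v)
    from sym.IH show ?case by (rule word_equiv.sym)
  next
    case (trans u v w')
    from trans.IH show ?case by (rule word_equiv.trans)
  next
    case (cancel u x b v)
    then show ?case using word_equiv.cancel[of R u x b "v @ w"] by simp
  next
    case (relation r s u v)
    then show ?case using word_equiv.relation[of r s R u "v @ w"] by simp
  qed
  show ?thesis
    using word_equiv.trans[OF right[OF assms(1)] left[OF assms(2)]] .
qed

lemma word_class_eq_iff: "word_class R u = word_class R v \<longleftrightarrow> word_equiv R u v"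
  unfolding word_class_def set_eq_iff mem_Collect_eq
  by (meson word_equiv.refl word_equiv.sym word_equiv.trans)

lemma presented_group_mult:
  "word_class R u \<otimes>\<^bsub>presented_group R\<^esub> word_class R v = word_class R (u @ v)"
proof -
  have eq: "word_class R (u' @ v') = word_class R (u @ v)"
    if "u' \<in> word_class R u" "v' \<in> word_class R v" for u' v'
  proof -
    have "word_equiv R (u @ v) (u' @ v')"
      using that by (simp add: word_class_def word_equiv_append)
    then show ?thesis
      unfolding word_class_eq_iff by (rule word_equiv.sym)
  qed
  have mem: "w \<in> word_class R w" for w
    by (simp add: word_class_def word_equiv.refl)
  have "(\<Union>u'\<in>word_class R u. \<Union>v'\<in>word_class R v. word_class R (u' @ v'))
      = (\<Union>u'\<in>word_class R u. \<Union>v'\<in>word_class R v. word_class R (u @ v))"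
    by (intro SUP_cong HOL.refl eq)
  also have "\<dots> = word_class R (u @ v)"
    using mem[of u] mem[of v] by blast
  finally show ?thesis
    by (simp add: presented_group_def)
qed

lemma word_equiv_inv_left: "word_equiv R (inv_word w @ w) []"
proof (induction w)
  case Nil
  show ?case by (simp add: inv_word_def word_equiv.refl)
next
  case (Cons l w)
  obtain x b where l: "l = (x, b)" by fastforce
  have "word_equiv R (inv_word (l # w) @ l # w) (inv_word w @ w)"
    using word_equiv.cancel[of R "inv_word w" x "\<not> b" w] by (simp add: l inv_word_def)
  then show ?case using Cons.IH by (rule word_equiv.trans)
qed

lemma group_presented_group: "group (presented_group R)"
proof (rule groupI, goal_cases)
  case (1 x y)
  then obtain u v where "x = word_class R u" "y = word_class R v"
    by (auto simp: presented_group_def)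
  then have "x \<otimes>\<^bsub>presented_group R\<^esub> y = word_class R (u @ v)"
    by (simp only: presented_group_mult)
  then show ?case by (simp add: presented_group_def)
next
  case 2
  show ?case by (simp add: presented_group_def)
next
  case (3 x y z)
  then obtain u v w where "x = word_class R u" "y = word_class R v" "z = word_class R w"
    by (auto simp: presented_group_def)
  then show ?case by (simp add: presented_group_mult)
next
  case (4 x)
  then obtain u where "x = word_class R u" by (auto simp: presented_group_def)
  moreover have "\<one>\<^bsub>presented_group R\<^esub> = word_class R []" by (simp add: presented_group_def)
  ultimately show ?case by (simp add: presented_group_mult)
next
  case (5 x)
  then obtain u where x: "x = word_class R u" by (auto simp: presented_group_def)
  have "word_class R (inv_word u) \<otimes>\<^bsub>presented_group R\<^esub> x = word_class R []"
    unfolding x presented_group_mult word_class_eq_iff by (rule word_equiv_inv_left)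
  then show ?case
    by (intro bexI[of _ "word_class R (inv_word u)"]) (simp_all add: presented_group_def)
qed


section \<open>The group of an integer function\<close>

datatype gen = Gen_t | Gen_a int | Gen_c int

abbreviation (input) t_word :: "gen gword" where "t_word \<equiv> gen_word Gen_t"
abbreviation (input) a_word :: "int \<Rightarrow> gen gword" where "a_word i \<equiv> gen_word (Gen_a i)"
abbreviation (input) c_word :: "int \<Rightarrow> gen gword" where "c_word i \<equiv> gen_word (Gen_c i)"

definition G_relations :: "(int \<Rightarrow> int) \<Rightarrow> (gen gword \<times> gen gword) set" where
  "G_relations d =
     {(t_word @ a_word i @ inv_word t_word, a_word (i + 1)) | i. True}
   \<union> {(t_word @ c_word i @ inv_word t_word, c_word i) | i. True}
   \<union> {(comm_word (a_word i) (a_word j), c_word (i - j)) | i j. True}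
   \<union> {(comm_word (c_word i) (a_word j), []) | i j. True}
   \<union> {(comm_word (c_word i) (c_word j), []) | i j. True}
   \<union> {(c_word i, pow_word (c_word 1) (d i)) | i. True}"

definition G_group :: "(int \<Rightarrow> int) \<Rightarrow> gen gword set monoid" where
  "G_group d = presented_group (G_relations d)"


section \<open>Antisymmetric functions, periodicity and conjugacy separability\<close>

definition antisymmetric_fun :: "(int \<Rightarrow> int) \<Rightarrow> bool" where
  "antisymmetric_fun d \<longleftrightarrow> (\<forall>i. d (- i) = - d i)"

definition periodic_mod :: "(int \<Rightarrow> int) \<Rightarrow> int \<Rightarrow> bool" where
  "periodic_mod d q \<longleftrightarrow> (\<exists>I\<ge>1. \<forall>n. [d (n + I) = d n] (mod q))"

definition conjugate_in :: "('a, 'b) monoid_scheme \<Rightarrow> 'a \<Rightarrow> 'a \<Rightarrow> bool" where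
  "conjugate_in G x y \<longleftrightarrow> (\<exists>g\<in>carrier G. y = g \<otimes>\<^bsub>G\<^esub> x \<otimes>\<^bsub>G\<^esub> inv\<^bsub>G\<^esub> g)"

definition conjugacy_separable :: "('a, 'b) monoid_scheme \<Rightarrow> bool" where
  "conjugacy_separable G \<longleftrightarrow>
     (\<forall>x\<in>carrier G. \<forall>y\<in>carrier G. \<not> conjugate_in G x y \<longrightarrow>
        (\<exists>N. N \<lhd> G \<and> finite (carrier (G Mod N)) \<and>
             \<not> conjugate_in (G Mod N) (N #>\<^bsub>G\<^esub> x) (N #>\<^bsub>G\<^esub> y)))"

end

theory Submission
  imports Defs "HOL-Library.Poly_Mapping" "HOL-Algebra.Multiplicative_Group"
begin

text \<open>
  Write \<open>c = c\<^sub>1\<close>. Every element of \<open>G\<^sub>d\<close> has the form \<open>a\<^sup>v c\<^sup>n t\<^sup>k\<close>, where \<open>v\<close> records the exponents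
  of the \<open>a\<^sub>i\<close>. Regard \<open>v\<close> as a Laurent polynomial over the integers, so that conjugation by \<open>t\<close> is
  multiplication by \<open>X\<close>; then \<open>[a\<^sup>v, a\<^sup>w] = c\<close> to the power \<open>\<omega>(v, w) = \<Sum> v\<^sub>i w\<^sub>j d(i - j)\<close>. The form \<open>\<omega>\<close>
  is bilinear, alternating and invariant under multiplication by \<open>X\<close>. Moving ordered products past
  each other gives a cocycle that is not alternating, but passing from the exponent \<open>n\<close> of \<open>c\<close> to
  \<open>s = 2 n\<close> plus a quadratic correction in \<open>v\<close> replaces it by \<open>\<omega>\<close> itself. Thus \<open>G\<^sub>d\<close> embeds into the
  group \<open>H\<close> of triples \<open>(v, s, k)\<close> with product
  \<open>(v + X\<^sup>k v', s + s' + \<omega>(v, X\<^sup>k v'), k + k')\<close>. Injectivity of the embedding is a normal form argument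
  (\<open>normal_form\<close>, \<open>eval_word_exponents_0\<close>). Since \<open>H\<close> is generated by the image and the central
  elements \<open>(0, s, 0)\<close>, conjugacy of two elements of the image means the same in both groups.

  Suppose that \<open>d\<close> is periodic modulo every \<open>q\<close>. If \<open>m\<close> is a period of \<open>d\<close> modulo \<open>q\<close>, then \<open>\<omega>\<close> is
  well defined modulo \<open>q\<close> on Laurent polynomials modulo the ideal \<open>(q, X\<^sup>m - 1)\<close>, and so \<open>H\<close> has a
  finite quotient in which \<open>v\<close> counts modulo this ideal, \<open>s\<close> modulo \<open>q\<close> and \<open>k\<close> modulo \<open>m\<close>. Let
  \<open>(v, s, k)\<close> and \<open>(v', s', k')\<close> be non-conjugate. If \<open>k \<noteq> k'\<close>, a large \<open>m\<close> separates them. If \<open>k = k'\<close>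
  and no \<open>v' = X\<^sup>l v + (1 - X\<^sup>k) w\<close>, then a suitable multiple \<open>m\<close> of \<open>k\<close> (a large \<open>m\<close> if \<open>k = 0\<close>) together
  with a \<open>q\<close> exceeding all coefficients that occur does so. Otherwise a conjugation achieves \<open>v = v'\<close>.
  If then \<open>k = 0\<close>, conjugation changes \<open>s\<close> by the multiples of a fixed integer, and \<open>q\<close> can be any
  nonzero multiple of that integer, or any large number if it is \<open>0\<close>. If \<open>k \<noteq> 0\<close>, no conjugation changes \<open>s\<close>: the elements
  that conjugate \<open>x = (v, s, k)\<close> into \<open>x\<close> times a central element form a group on which this central
  element is additive; it vanishes at \<open>x\<close>, and a power of every such element differs from a power
  of \<open>x\<close> by a central factor. The same reasoning in the finite quotient (\<open>H_cong_conj_by_central_power\<close>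
  and \<open>H_cong_conj_by_central\<close>) shows that a change \<open>e\<close> of \<open>s\<close> satisfies \<open>k e \<equiv> 0\<close> modulo \<open>q\<close>, provided
  that \<open>m\<close> is \<open>q k\<close> times a period, and a \<open>q\<close> not dividing \<open>k e\<close> separates.

  Conversely, \<open>a\<^sub>0\<^sup>q\<close> is conjugate to \<open>a\<^sub>0\<^sup>q c\<^sup>n\<close> exactly when \<open>q\<close> divides \<open>n\<close>. In a finite quotient, let
  \<open>r\<close> be the order of \<open>c\<close>. The order of \<open>t\<close> is a period of the images of the \<open>a\<^sub>i\<close>, hence, through
  \<open>[a\<^sub>n, a\<^sub>0] = c\<close> to the power \<open>d(n)\<close>, a period of \<open>d\<close> modulo \<open>r\<close>. If the quotient separates \<open>a\<^sub>0\<^sup>q\<close>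
  from \<open>a\<^sub>0\<^sup>q c\<^sup>n\<close>, then \<open>gcd(r, q)\<close> does not divide \<open>n\<close>. So for the largest divisor \<open>n\<close> of \<open>q\<close> modulo
  which \<open>d\<close> is periodic, \<open>n \<noteq> q\<close> would make \<open>d\<close> periodic modulo the larger divisor
  \<open>lcm(n, gcd(r, q))\<close>.
\<close>

section \<open>Integral Laurent polynomials\<close>

type_synonym laurent = "int \<Rightarrow>\<^sub>0 int"

definition X :: "int \<Rightarrow> laurent" where
  "X k = frag_of k"

lemma X_0 [simp]: "X 0 = 1"
  by (simp add: X_def)

lemma X_add: "X (a + b) = X a * X b"
  by (simp add: X_def mult_single)

lemma X_minus_mult [simp]: "X (- k) * X k = 1" "X k * X (- k) = 1"
  by (simp_all flip: X_add)

lemma X_minus_mult_left [simp]: "X (- k) * (X k * v) = v" "X k * (X (- k) * v) = v"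
  by (simp_all flip: mult.assoc)

lemma X_power: "X (int n * k) = X k ^ n"
  by (induction n) (simp_all add: X_add algebra_simps)

lemma X_nonzero [simp]: "X k \<noteq> 0"
  by (simp add: X_def)

lemma laurent_induct [case_names zero X diff]:
  fixes v :: laurent
  assumes "P 0" "\<And>i. P (X i)" "\<And>u w. P u \<Longrightarrow> P w \<Longrightarrow> P (u - w)"
  shows "P v"
  using frag_induction[of v UNIV P] assms by (auto simp: X_def)

lemma lookup_of_int_mult: "Poly_Mapping.lookup (of_int q * v) i = q * Poly_Mapping.lookup v i"
  for v :: laurent
proof (induction v rule: laurent_induct)
  case (X j)
  have "of_int q * X j = Poly_Mapping.single j q"
    unfolding X_def using mult_single[of 0 q j 1] single_of_int[of q]
    by (metis add_0 mult.right_neutral of_int_eq_id id_apply)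
  then show ?case by (simp add: X_def lookup_single when_def)
qed (simp_all add: right_diff_distrib lookup_minus)

lemma lookup_X_mult: "Poly_Mapping.lookup (X l * v) i = Poly_Mapping.lookup v (i - l)"
  by (induction v rule: laurent_induct)
    (auto simp: X_def mult_single right_diff_distrib lookup_minus)

lemma keys_X_mult: "Poly_Mapping.keys (X l * v) = (\<lambda>i. i + l) ` Poly_Mapping.keys v"
proof (intro Set.set_eqI iffI)
  fix i assume "i \<in> Poly_Mapping.keys (X l * v)"
  then have "i - l \<in> Poly_Mapping.keys v" by (simp add: in_keys_iff lookup_X_mult)
  then show "i \<in> (\<lambda>i. i + l) ` Poly_Mapping.keys v" by (rule rev_image_eqI) simp
qed (auto simp: in_keys_iff lookup_X_mult)

definition linear_extension :: "(int \<Rightarrow> int) \<Rightarrow> laurent \<Rightarrow> int" where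
  "linear_extension d v = (\<Sum>i\<in>Poly_Mapping.keys v. Poly_Mapping.lookup v i * d i)"

lemma linear_extension_superset:
  assumes "finite A" "Poly_Mapping.keys v \<subseteq> A"
  shows "linear_extension d v = (\<Sum>i\<in>A. Poly_Mapping.lookup v i * d i)"
  unfolding linear_extension_def
  by (rule sum.mono_neutral_left) (use assms in \<open>auto simp: in_keys_iff\<close>)

lemma linear_extension_0 [simp]: "linear_extension d 0 = 0"
  by (simp add: linear_extension_def)

lemma linear_extension_X [simp]: "linear_extension d (X i) = d i"
  by (simp add: linear_extension_def X_def)

lemma linear_extension_diff:
  "linear_extension d (u - v) = linear_extension d u - linear_extension d v"
proof -
  let ?A = "Poly_Mapping.keys u \<union> Poly_Mapping.keys v"
  have "Poly_Mapping.keys (u - v) \<subseteq> ?A" by (rule keys_diff)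
  then show ?thesis
    by (simp add: linear_extension_superset[of ?A] lookup_minus left_diff_distrib sum_subtractf)
qed

lemma linear_extension_minus: "linear_extension d (- v) = - linear_extension d v"
  using linear_extension_diff[of d 0 v] by simp

lemma linear_extension_add:
  "linear_extension d (u + v) = linear_extension d u + linear_extension d v"
  using linear_extension_diff[of d u "- v"] by (simp add: linear_extension_minus)

lemma linear_extension_sum:
  "linear_extension d (sum f A) = (\<Sum>a\<in>A. linear_extension d (f a))"
  by (induction A rule: infinite_finite_induct) (simp_all add: linear_extension_add)

lemma linear_extension_of_int_mult:
  "linear_extension d (of_int q * v) = q * linear_extension d v"
proof -
  have "Poly_Mapping.keys (of_int q * v) \<subseteq> Poly_Mapping.keys v"
    by (auto simp: in_keys_iff lookup_of_int_mult)
  then show ?thesis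
    by (simp add: linear_extension_superset[of "Poly_Mapping.keys v"] lookup_of_int_mult
        sum_distrib_left mult.assoc)
qed

text \<open>The involution of the ring that sends \<open>X\<close> to its inverse.\<close>

definition bar :: "laurent \<Rightarrow> laurent" where
  "bar v = frag_extend (\<lambda>i. X (- i)) v"

lemma bar_simps [simp]:
  "bar 0 = 0" "bar (X i) = X (- i)" "bar (u - v) = bar u - bar v"
  "bar (- v) = - bar v" "bar (u + v) = bar u + bar v"
  by (simp_all add: bar_def X_def frag_extend_diff frag_extend_minus frag_extend_add)

lemma bar_mult [simp]: "bar (u * v) = bar u * bar v"
proof (induction u rule: laurent_induct)
  case (X i)
  show ?case
  proof (induction v rule: laurent_induct)
    case (X j)
    have "bar (X (i + j)) = X (- i) * X (- j)" by (simp flip: X_add)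
    then show ?case by (simp add: X_add)
  qed (simp_all add: right_diff_distrib)
qed (simp_all add: left_diff_distrib)

lemma bar_bar [simp]: "bar (bar v) = v"
  by (induction v rule: laurent_induct) simp_all

section \<open>Folding exponents modulo a period\<close>

lemma X_minus_1_dvd_int_mult: "X k - 1 dvd X (n * k) - 1"
proof -
  have nat: "X k - 1 dvd X (int m * k) - 1" for m
    unfolding X_power using power_diff_1_eq[of "X k" m] by simp
  show ?thesis
  proof (cases n rule: int_cases2)
    case (nonneg m)
    then show ?thesis using nat by simp
  next
    case (nonpos m)
    have "X (n * k) - 1 = (X (int m * k) - 1) * (- X (n * k))"
      by (simp add: nonpos left_diff_distrib)
    then show ?thesis using nat[of m] by (metis dvd_mult2)
  qed
qed

lemma X_minus_1_dvd_X_diff: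
  assumes "k dvd a - b"
  shows "X k - 1 dvd X a - X b"
proof -
  obtain n where n: "a - b = k * n" using assms by (elim dvdE)
  have "X a - X b = X b * (X (a - b) - 1)"
    by (simp add: right_diff_distrib flip: X_add)
  then show ?thesis
    using X_minus_1_dvd_int_mult[of k n] n by (simp add: mult.commute)
qed

text \<open>A normal form modulo \<open>X\<^sup>k - 1\<close>.\<close>

definition fold_mod :: "int \<Rightarrow> laurent \<Rightarrow> laurent" where
  "fold_mod k v = frag_extend (\<lambda>i. X (i mod k)) v"

lemma fold_mod_simps [simp]:
  "fold_mod k 0 = 0" "fold_mod k (X i) = X (i mod k)"
  "fold_mod k (u - v) = fold_mod k u - fold_mod k v"
  "fold_mod k (u + v) = fold_mod k u + fold_mod k v"
  by (simp_all add: fold_mod_def X_def frag_extend_diff frag_extend_add)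

lemma X_minus_1_dvd_diff_fold_mod: "X k - 1 dvd v - fold_mod k v"
proof (induction v rule: laurent_induct)
  case (X i)
  show ?case by (simp add: X_minus_1_dvd_X_diff mod_eq_dvd_iff[symmetric])
next
  case (diff u w)
  have "u - w - fold_mod k (u - w) = (u - fold_mod k u) - (w - fold_mod k w)" by simp
  then show ?case using diff by (metis dvd_diff)
qed simp

lemma fold_mod_eq_0_iff: "fold_mod k v = 0 \<longleftrightarrow> X k - 1 dvd v"
proof
  assume "fold_mod k v = 0"
  then show "X k - 1 dvd v" using X_minus_1_dvd_diff_fold_mod[of k v] by simp
next
  assume "X k - 1 dvd v"
  then obtain u where v: "v = (X k - 1) * u" by (elim dvdE)
  show "fold_mod k v = 0"
    unfolding v
  proof (induction u rule: laurent_induct)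
    case (X i)
    have "(X k - 1) * X i = X (k + i) - X i" by (simp add: left_diff_distrib X_add)
    then show ?case by simp
  qed (simp_all add: right_diff_distrib del: left_diff_distrib_numeral)
qed

lemma fold_mod_of_int_mult: "fold_mod k (of_int q * v) = of_int q * fold_mod k v"
proof -
  have *: "of_int q * u = frag_cmul q u" for u :: laurent
    by (rule poly_mapping_eqI) (simp add: lookup_of_int_mult)
  show ?thesis by (simp add: * fold_mod_def frag_extend_cmul)
qed

lemma fold_mod_id:
  assumes "Poly_Mapping.keys v \<subseteq> {0..<k}"
  shows "fold_mod k v = v"
proof -
  have "fold_mod k v = frag_extend frag_of v"
    unfolding fold_mod_def
    by (rule frag_extend_eq) (use assms in \<open>auto simp: X_def\<close>)
  then show ?thesis using frag_expansion[of v] by simp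
qed

lemma keys_fold_mod: "Poly_Mapping.keys (fold_mod k v) \<subseteq> (\<lambda>i. i mod k) ` Poly_Mapping.keys v"
  unfolding fold_mod_def using keys_frag_extend[of "\<lambda>i. X (i mod k)" v] by (auto simp: X_def)

text \<open>Once the window of exponents is shifted to start at \<open>0\<close>, folding is the identity.\<close>

lemma short_multiple_of_X_minus_1:
  assumes "X k - 1 dvd v" "Poly_Mapping.keys v \<subseteq> {a..<a + k}"
  shows "v = 0"
proof -
  have "X k - 1 dvd X (- a) * v" using assms(1) by simp
  moreover have "Poly_Mapping.keys (X (- a) * v) \<subseteq> {0..<k}"
    using assms(2) by (auto simp: keys_X_mult)
  ultimately have "X (- a) * v = 0"
    using fold_mod_id fold_mod_eq_0_iff by metis
  then show ?thesis by simp
qed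

definition l1_norm :: "laurent \<Rightarrow> int" where
  "l1_norm v = (\<Sum>i\<in>Poly_Mapping.keys v. \<bar>Poly_Mapping.lookup v i\<bar>)"

lemma l1_norm_nonneg: "l1_norm v \<ge> 0"
  by (simp add: l1_norm_def sum_nonneg)

lemma l1_norm_X_mult [simp]: "l1_norm (X l * v) = l1_norm v"
  unfolding l1_norm_def keys_X_mult
  by (subst sum.reindex) (auto simp: lookup_X_mult)

lemma lookup_fold_mod_le: "\<bar>Poly_Mapping.lookup (fold_mod k v) i\<bar> \<le> l1_norm v"
proof -
  have "Poly_Mapping.lookup (fold_mod k v) i =
      (\<Sum>j\<in>Poly_Mapping.keys v. Poly_Mapping.lookup v j * (if i = j mod k then 1 else 0))"
    by (simp add: fold_mod_def frag_extend_def lookup_sum X_def)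
  also have "\<bar>\<dots>\<bar> \<le> (\<Sum>j\<in>Poly_Mapping.keys v. \<bar>Poly_Mapping.lookup v j * (if i = j mod k then 1 else 0)\<bar>)"
    by (rule sum_abs)
  also have "\<dots> \<le> l1_norm v"
    unfolding l1_norm_def by (rule sum_mono) auto
  finally show ?thesis .
qed

lemma of_int_dvd_laurent_iff: "of_int q dvd v \<longleftrightarrow> (\<forall>i. q dvd Poly_Mapping.lookup v i)"
  for v :: laurent
proof
  assume "\<forall>i. q dvd Poly_Mapping.lookup v i"
  then have "v = of_int q * Poly_Mapping.map (\<lambda>c. c div q) v"
    by (intro poly_mapping_eqI) (auto simp: lookup_of_int_mult map.rep_eq when_def)
  then show "of_int q dvd v" by (rule dvdI)
qed (auto simp: lookup_of_int_mult elim: dvdE)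

text \<open>Only finitely many coefficients of \<open>z\<close> are nonzero, and the hypothesis makes the coefficients
  modulo \<open>q\<close> constant along each residue class modulo \<open>k\<close>; an infinite class must meet a zero.\<close>

lemma of_int_dvd_X_minus_1_mult:
  assumes "of_int q dvd (X k - 1) * z" "k \<noteq> 0"
  shows "of_int q dvd z"
  unfolding of_int_dvd_laurent_iff
proof
  fix i
  have step: "q dvd Poly_Mapping.lookup z (j - k) - Poly_Mapping.lookup z j" for j
    using assms(1) unfolding of_int_dvd_laurent_iff
    by (simp add: left_diff_distrib lookup_minus lookup_X_mult)
  have *: "q dvd Poly_Mapping.lookup z (i - int n * k) - Poly_Mapping.lookup z i" for n
  proof (induction n)
    case (Suc n)
    from dvd_add[OF step[of "i - int n * k"] Suc] show ?case by (simp add: algebra_simps)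
  qed simp
  have "inj (\<lambda>n. i - int n * k)" using assms(2) by (auto intro: injI)
  then have "infinite (range (\<lambda>n. i - int n * k))" by (simp add: finite_image_iff)
  then obtain n where "i - int n * k \<notin> Poly_Mapping.keys z"
    by (meson finite_keys finite_subset image_subset_iff)
  then show "q dvd Poly_Mapping.lookup z i"
    using *[of n] by (simp add: in_keys_iff)
qed

section \<open>The ideals generated by an integer and a period\<close>

definition periodic_ideal :: "int \<Rightarrow> int \<Rightarrow> laurent set" where
  "periodic_ideal q k = {(X k - 1) * a + of_int q * b | a b. True}"

lemma periodic_idealI: "(X k - 1) * a + of_int q * b \<in> periodic_ideal q k"
  by (auto simp: periodic_ideal_def)

lemma periodic_ideal_add:
  assumes "u \<in> periodic_ideal q k" "v \<in> periodic_ideal q k"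
  shows "u + v \<in> periodic_ideal q k"
proof -
  obtain a b where u: "u = (X k - 1) * a + of_int q * b"
    using assms(1) by (auto simp: periodic_ideal_def)
  obtain a' b' where v: "v = (X k - 1) * a' + of_int q * b'"
    using assms(2) by (auto simp: periodic_ideal_def)
  have "u + v = (X k - 1) * (a + a') + of_int q * (b + b')"
    unfolding u v by (simp add: algebra_simps)
  then show ?thesis using periodic_idealI by metis
qed

lemma periodic_ideal_mult:
  assumes "u \<in> periodic_ideal q k"
  shows "u * w \<in> periodic_ideal q k" "w * u \<in> periodic_ideal q k"
proof -
  obtain a b where u: "u = (X k - 1) * a + of_int q * b"
    using assms(1) by (auto simp: periodic_ideal_def)
  have "u * w = (X k - 1) * (a * w) + of_int q * (b * w)"
    unfolding u by (simp add: algebra_simps)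
  then show "u * w \<in> periodic_ideal q k" using periodic_idealI by metis
  then show "w * u \<in> periodic_ideal q k" by (simp add: mult.commute)
qed

lemma periodic_ideal_0 [simp]: "0 \<in> periodic_ideal q k"
  using periodic_idealI[of k 0 q 0] by simp

lemma periodic_ideal_minus: "u \<in> periodic_ideal q k \<Longrightarrow> - u \<in> periodic_ideal q k"
  using periodic_ideal_mult(1)[of u q k "- 1"] by simp

lemma X_diff_in_periodic_ideal: "k dvd a - b \<Longrightarrow> X a - X b \<in> periodic_ideal q k"
  using X_minus_1_dvd_X_diff[of k a b] periodic_idealI[of k _ q 0] by (auto elim!: dvdE)

lemma dvd_lookup_fold_mod:
  assumes "v \<in> periodic_ideal q k" "l dvd k"
  shows "q dvd Poly_Mapping.lookup (fold_mod l v) i"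
proof -
  obtain a b where v: "v = (X k - 1) * a + of_int q * b"
    using assms(1) by (auto simp: periodic_ideal_def)
  have "X l - 1 dvd X k - X 0" by (rule X_minus_1_dvd_X_diff) (use assms(2) in simp)
  then have "fold_mod l ((X k - 1) * a) = 0" by (simp add: fold_mod_eq_0_iff)
  then show ?thesis
    by (simp add: v fold_mod_of_int_mult lookup_add lookup_of_int_mult)
qed

text \<open>Folding the exponents modulo \<open>k\<close> and then reducing the coefficients modulo \<open>q\<close> leaves a finite
  set. The window for the exponents is symmetric because \<open>k\<close> may be negative.\<close>

lemma finite_representatives_periodic_ideal:
  assumes "q > 0" "k \<noteq> 0"
  obtains R where "finite R" "\<And>v. \<exists>u\<in>R. v - u \<in> periodic_ideal q k"
proof
  let ?A = "{- \<bar>k\<bar>..\<bar>k\<bar>}"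
  let ?F = "{f. \<forall>i. (i \<in> ?A \<longrightarrow> f i \<in> {0..<q}) \<and> (i \<notin> ?A \<longrightarrow> f i = 0)}"
  let ?R = "Poly_Mapping.lookup -` ?F"
  have "finite ?F" by (rule finite_set_of_finite_funs) simp_all
  moreover have "inj (Poly_Mapping.lookup :: laurent \<Rightarrow> _)"
    by (rule injI) (simp add: poly_mapping_eqI)
  ultimately show "finite ?R" by (rule finite_vimageI)
  fix v
  define w where "w = fold_mod k v"
  define u where "u = Poly_Mapping.map (\<lambda>c. c mod q) w"
  have lu: "Poly_Mapping.lookup u i = Poly_Mapping.lookup w i mod q" for i
    by (simp add: u_def map.rep_eq when_def)
  have "i mod k \<in> ?A" for i
    using abs_mod_less[of k i] assms(2) by auto
  then have "Poly_Mapping.keys w \<subseteq> ?A"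
    using keys_fold_mod[of k v] unfolding w_def by blast
  then have "Poly_Mapping.lookup w i = 0" if "i \<notin> ?A" for i
    using that by (meson in_keys_iff subsetD)
  then have "u \<in> ?R"
    using assms(1) by (simp add: lu)
  moreover have "of_int q dvd w - u"
    by (simp add: of_int_dvd_laurent_iff lookup_minus lu minus_mod_eq_mult_div)
  then obtain b where b: "w - u = of_int q * b" by (elim dvdE)
  obtain a where a: "v - w = (X k - 1) * a"
    using X_minus_1_dvd_diff_fold_mod[of k v] unfolding w_def by (elim dvdE)
  have "v - u = (X k - 1) * a + of_int q * b" by (simp flip: a b)
  then have "v - u \<in> periodic_ideal q k" by (metis periodic_idealI)
  ultimately show "\<exists>u\<in>?R. v - u \<in> periodic_ideal q k" by blast
qed

section \<open>The commutator form\<close>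

locale antisymmetric_sequence =
  fixes d :: "int \<Rightarrow> int"
  assumes d_minus: "d (- i) = - d i"
    and d_1: "d 1 = 1"
begin

text \<open>The bilinear extension of \<open>(X\<^sup>i, X\<^sup>j) \<mapsto> d (i - j)\<close>. Expressing it through a product of Laurent
  polynomials makes the shift-invariance and the behaviour on ideals consequences of ring identities.\<close>

definition \<omega> :: "laurent \<Rightarrow> laurent \<Rightarrow> int" where
  "\<omega> v w = linear_extension d (v * bar w)"

lemma \<omega>_0 [simp]: "\<omega> 0 w = 0" "\<omega> v 0 = 0"
  by (simp_all add: \<omega>_def)

lemma \<omega>_add: "\<omega> (u + v) w = \<omega> u w + \<omega> v w" "\<omega> u (v + w) = \<omega> u v + \<omega> u w"
  by (simp_all add: \<omega>_def linear_extension_add distrib_left distrib_right)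

lemma \<omega>_minus: "\<omega> (- v) w = - \<omega> v w" "\<omega> v (- w) = - \<omega> v w"
  by (simp_all add: \<omega>_def linear_extension_minus)

lemma \<omega>_diff: "\<omega> (u - v) w = \<omega> u w - \<omega> v w" "\<omega> u (v - w) = \<omega> u v - \<omega> u w"
  by (simp_all add: \<omega>_def linear_extension_diff left_diff_distrib right_diff_distrib)

lemma \<omega>_of_int_mult:
  "\<omega> (of_int q * v) w = q * \<omega> v w"
  by (simp add: \<omega>_def mult.assoc linear_extension_of_int_mult)

lemma \<omega>_X_X: "\<omega> (X i) (X j) = d (i - j)"
  by (simp add: \<omega>_def flip: X_add)

lemma \<omega>_shift: "\<omega> (X k * v) (X k * w) = \<omega> v w"
proof -
  have "X k * v * (X (- k) * bar w) = X k * X (- k) * (v * bar w)"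
    by (simp only: ac_simps)
  also have "\<dots> = v * bar w" by simp
  finally show ?thesis by (simp only: \<omega>_def bar_mult bar_simps)
qed

lemma \<omega>_swap: "\<omega> w v = - \<omega> v w"
proof -
  have "linear_extension d (bar u) = - linear_extension d u" for u
    by (induction u rule: laurent_induct) (simp_all add: d_minus linear_extension_diff)
  from this[of "v * bar w"] show ?thesis
    by (simp add: \<omega>_def mult.commute)
qed

lemma \<omega>_self [simp]: "\<omega> v v = 0"
  using \<omega>_swap[of v v] by simp

definition period :: "int \<Rightarrow> int \<Rightarrow> bool" where
  "period q k \<longleftrightarrow> (\<forall>n. q dvd d (n + k) - d n)"

lemma period_mult:
  assumes "period q k"
  shows "period q (k * m)"
proof -
  have nat: "q dvd d (n + k * int i) - d n" for n i
  proof (induction i)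
    case (Suc i)
    have "q dvd d (n + k * int i + k) - d (n + k * int i)"
      using assms by (simp add: period_def)
    from dvd_add[OF this Suc] show ?case by (simp add: algebra_simps)
  qed simp
  show ?thesis
    unfolding period_def
  proof
    fix n
    show "q dvd d (n + k * m) - d n"
    proof (cases m rule: int_cases2)
      case (nonneg i)
      then show ?thesis using nat by simp
    next
      case (nonpos i)
      then show ?thesis using nat[of "n + k * m" i] by (simp add: dvd_diff_commute)
    qed
  qed
qed

lemma period_dvd: "period q k \<Longrightarrow> r dvd q \<Longrightarrow> period r k"
  unfolding period_def using dvd_trans by blast

lemma period_lcm:
  assumes "period q k" "period r l"
  shows "period (lcm q r) (k * l)"
  using period_mult[OF assms(1), of l] period_mult[OF assms(2), of k]
  by (simp add: period_def mult.commute)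

text \<open>This is where periodicity enters: a period of \<open>d\<close> modulo \<open>q\<close> makes the linear extension vanish
  modulo \<open>q\<close> on the whole ideal, so that \<open>\<omega>\<close> modulo \<open>q\<close> descends to the quotient by it.\<close>

lemma linear_extension_periodic_ideal:
  assumes "period q k" "u \<in> periodic_ideal q k"
  shows "q dvd linear_extension d u"
proof -
  obtain a b where u: "u = (X k - 1) * a + of_int q * b"
    using assms(2) by (auto simp: periodic_ideal_def)
  have "q dvd linear_extension d ((X k - 1) * a)"
  proof (induction a rule: laurent_induct)
    case (X i)
    have "(X k - 1) * X i = X (i + k) - X i" by (simp add: X_add algebra_simps)
    then show ?case using assms(1) by (simp add: linear_extension_diff period_def)
  next
    case (diff u w)
    then show ?case by (simp only: right_diff_distrib linear_extension_diff dvd_diff)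
  qed simp
  then show ?thesis
    by (simp add: u linear_extension_add linear_extension_of_int_mult)
qed

lemma \<omega>_periodic_ideal:
  assumes "period q k" "u \<in> periodic_ideal q k"
  shows "q dvd \<omega> u v" "q dvd \<omega> v u"
proof -
  show "q dvd \<omega> u v"
    unfolding \<omega>_def using assms periodic_ideal_mult linear_extension_periodic_ideal by blast
  then show "q dvd \<omega> v u" using \<omega>_swap[of u v] by simp
qed

text \<open>Modulo \<open>q\<close> and \<open>X\<^sup>k\<^sup>p\<^sup>q - 1\<close>, the annihilator of \<open>1 - X\<^sup>k\<close> is generated by the geometric sum
  \<open>1 + X\<^sup>k + X\<^sup>2\<^sup>k + \<dots>\<close> of \<open>p q\<close> terms. It factors into a sum of \<open>p\<close> terms and a sum \<open>T\<close> of \<open>q\<close> powers of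
  \<open>X\<^sup>k\<^sup>p\<close>; as \<open>k p\<close> is a period, each of these \<open>q\<close> powers acts trivially, so \<open>T\<close> acts as
  multiplication by \<open>q\<close>. This is the reason for the factor \<open>q\<close> in the modulus \<open>k p q\<close>.\<close>

lemma \<omega>_annihilator:
  assumes per: "period q p" and pos: "p \<ge> 1" "q \<ge> 1" and k: "k \<noteq> 0"
    and w: "(1 - X k) * w \<in> periodic_ideal q (k * p * q)"
  shows "q dvd \<omega> w v"
proof -
  define S where "S = (\<Sum>i<nat p. X k ^ i)"
  define T where "T = (\<Sum>i<nat q. X (k * p) ^ i)"
  have y: "X (k * p) = X k ^ nat p"
    using X_power[of "nat p" k] pos by (simp add: mult.commute)
  have "X (k * p * q) - 1 = X (k * p) ^ nat q - 1"
    using X_power[of "nat q" "k * p"] pos by (simp add: mult.commute)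
  also have "\<dots> = (X (k * p) - 1) * T"
    unfolding T_def by (rule power_diff_1_eq)
  also have "X (k * p) - 1 = (X k - 1) * S"
    unfolding y S_def by (rule power_diff_1_eq)
  finally have fac: "X (k * p * q) - 1 = (X k - 1) * S * T" .
  obtain a b where "(1 - X k) * w = (X (k * p * q) - 1) * a + of_int q * b"
    using w by (auto simp: periodic_ideal_def)
  moreover have "(X k - 1) * (w + S * T * a) = (X k - 1) * S * T * a - (1 - X k) * w"
    by (simp add: algebra_simps)
  ultimately have "(X k - 1) * (w + S * T * a) = of_int q * (- b)"
    unfolding fac by simp
  then have "of_int q dvd w + S * T * a"
    using of_int_dvd_X_minus_1_mult k by (metis dvd_triv_left)
  then obtain c where "w + S * T * a = of_int q * c" by (elim dvdE)
  then have w_eq: "w = of_int q * c - T * (S * a)" by (simp add: algebra_simps)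
  have "q dvd \<omega> (T * z) v" for z
  proof -
    have per': "period q (k * p)" using period_mult[OF per, of k] by (simp add: mult.commute)
    have *: "q dvd \<omega> (X (k * p) ^ i * z) v - \<omega> z v" for i
    proof -
      have "X (int i * (k * p)) - X 0 \<in> periodic_ideal q (k * p)"
        by (rule X_diff_in_periodic_ideal) simp
      from \<omega>_periodic_ideal(1)[OF per' periodic_ideal_mult(1)[OF this, of z], of v]
      show ?thesis by (simp add: X_power left_diff_distrib \<omega>_diff)
    qed
    have "\<omega> (T * z) v = (\<Sum>i<nat q. \<omega> (X (k * p) ^ i * z) v)"
      by (simp add: \<omega>_def T_def sum_distrib_right linear_extension_sum mult.assoc)
    also have "\<dots> = (\<Sum>i<nat q. \<omega> (X (k * p) ^ i * z) v - \<omega> z v) + q * \<omega> z v"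
      using pos by (simp add: sum_subtractf)
    finally show ?thesis
      using * by (simp add: dvd_sum)
  qed
  then show ?thesis
    unfolding w_eq by (simp add: \<omega>_diff \<omega>_of_int_mult)
qed

section \<open>A group of triples\<close>

text \<open>The semidirect product of a Heisenberg group, built from \<open>\<omega>\<close>, with the integers acting by
  multiplication by powers of \<open>X\<close>. The elements \<open>(0, s, 0)\<close> are central. Since \<open>\<omega>\<close> is
  alternating, commutators in the Heisenberg part are \<open>2 \<omega>\<close>, so \<open>c\<close> will correspond to \<open>(0, 2, 0)\<close>.\<close>

definition H :: "(laurent \<times> int \<times> int) monoid" where
  "H = \<lparr>carrier = UNIV,
        monoid.mult = (\<lambda>(v, s, k) (v', s', k'). (v + X k * v', s + s' + \<omega> v (X k * v'), k + k')),
        one = (0, 0, 0)\<rparr>"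

lemma H_carrier [simp]: "x \<in> carrier H"
  by (simp add: H_def)

lemma H_one: "\<one>\<^bsub>H\<^esub> = (0, 0, 0)"
  by (simp add: H_def)

lemma H_mult: "(v, s, k) \<otimes>\<^bsub>H\<^esub> (v', s', k') =
    (v + X k * v', s + s' + \<omega> v (X k * v'), k + k')"
  by (simp add: H_def)

lemma H_inv_left: "(- (X (- k) * v), - s, - k) \<otimes>\<^bsub>H\<^esub> (v, s, k) = \<one>\<^bsub>H\<^esub>"
  by (simp add: H_mult H_one \<omega>_minus)

lemma group_H: "group H"
proof (rule groupI)
  fix x y z :: "laurent \<times> int \<times> int"
  obtain v s k v' s' k' v'' s'' k'' where [simp]:
    "x = (v, s, k)" "y = (v', s', k')" "z = (v'', s'', k'')" by (metis prod_cases3)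
  have "\<omega> v' (X k' * v'') = \<omega> (X k * v') (X (k + k') * v'')"
    by (simp add: X_add mult.assoc \<omega>_shift)
  then show "x \<otimes>\<^bsub>H\<^esub> y \<otimes>\<^bsub>H\<^esub> z = x \<otimes>\<^bsub>H\<^esub> (y \<otimes>\<^bsub>H\<^esub> z)"
    by (simp add: H_mult \<omega>_add X_add distrib_left mult.assoc)
  show "\<exists>y\<in>carrier H. y \<otimes>\<^bsub>H\<^esub> x = \<one>\<^bsub>H\<^esub>"
    using H_inv_left[of k v s] by auto
  show "\<one>\<^bsub>H\<^esub> \<otimes>\<^bsub>H\<^esub> x = x"
    by (simp add: H_mult H_one)
qed simp_all

sublocale H: group H
  by (rule group_H)

lemma H_inv: "inv\<^bsub>H\<^esub> (v, s, k) = (- (X (- k) * v), - s, - k)"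
  by (rule H.inv_equality[OF H_inv_left]) simp_all

definition conj_by :: "laurent \<times> int \<times> int \<Rightarrow> laurent \<times> int \<times> int \<Rightarrow> laurent \<times> int \<times> int" where
  "conj_by g x = g \<otimes>\<^bsub>H\<^esub> x \<otimes>\<^bsub>H\<^esub> inv\<^bsub>H\<^esub> g"

lemma conj_by: "conj_by (w, r, l) (v, s, k) =
    (X l * v + (1 - X k) * w, s + \<omega> w (X l * v) - \<omega> (w + X l * v) (X k * w), k)"
proof -
  have "X l * (X k * (X (- l) * w)) = X k * w"
    using mult.left_commute[of "X l" "X k" "X (- l) * w"] by simp
  then have *: "X (l + k) * (X (- l) * w) = X k * w"
    by (simp only: X_add mult.assoc)
  show ?thesis
    by (simp add: conj_by_def H_mult H_inv * \<omega>_minus left_diff_distrib)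
qed

lemma conj_by_mult: "conj_by g (conj_by h x) = conj_by (g \<otimes>\<^bsub>H\<^esub> h) x"
  by (simp add: conj_by_def H.inv_mult_group H.m_assoc)

lemma conj_by_one [simp]: "conj_by \<one>\<^bsub>H\<^esub> x = x"
  by (simp add: conj_by_def)

section \<open>Finite quotients of the group of triples\<close>

text \<open>If \<open>m\<close> is a period of \<open>d\<close> modulo \<open>q\<close>, this is the congruence of a normal subgroup of finite index,
  and working with it replaces computations with cosets.\<close>

fun H_cong :: "int \<Rightarrow> int \<Rightarrow> laurent \<times> int \<times> int \<Rightarrow> laurent \<times> int \<times> int \<Rightarrow> bool" where
  "H_cong q m (v, s, k) (v', s', k') \<longleftrightarrow>
     v - v' \<in> periodic_ideal q m \<and> q dvd s - s' \<and> m dvd k - k'"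

lemma H_cong_refl [simp]: "H_cong q m x x"
  by (cases x) simp

lemma H_cong_sym: "H_cong q m x y \<Longrightarrow> H_cong q m y x"
  by (cases x; cases y) (use periodic_ideal_minus in \<open>fastforce simp: dvd_diff_commute\<close>)

lemma H_cong_trans:
  assumes "H_cong q m x y" "H_cong q m y z"
  shows "H_cong q m x z"
proof -
  obtain v s k v' s' k' v'' s'' k'' where [simp]:
    "x = (v, s, k)" "y = (v', s', k')" "z = (v'', s'', k'')" by (metis prod_cases3)
  from assms show ?thesis
    using periodic_ideal_add[of "v - v'" q m "v' - v''"] dvd_add[of q "s - s'" "s' - s''"]
      dvd_add[of m "k - k'" "k' - k''"] by simp
qed

lemma H_cong_mult:
  assumes per: "period q m" and "H_cong q m x x'" "H_cong q m y y'"
  shows "H_cong q m (x \<otimes>\<^bsub>H\<^esub> y) (x' \<otimes>\<^bsub>H\<^esub> y')"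
proof -
  obtain v1 s1 k1 v2 s2 k2 where [simp]: "x = (v1, s1, k1)" "x' = (v2, s2, k2)"
    by (metis prod_cases3)
  obtain w1 r1 l1 w2 r2 l2 where [simp]: "y = (w1, r1, l1)" "y' = (w2, r2, l2)"
    by (metis prod_cases3)
  have v: "v1 - v2 \<in> periodic_ideal q m" and s: "q dvd s1 - s2" and k: "m dvd k1 - k2"
    and w: "w1 - w2 \<in> periodic_ideal q m" and r: "q dvd r1 - r2" and l: "m dvd l1 - l2"
    using assms(2,3) by simp_all
  have "X k1 * (w1 - w2) + (X k1 - X k2) * w2 \<in> periodic_ideal q m"
    by (intro periodic_ideal_add periodic_ideal_mult X_diff_in_periodic_ideal w k)
  then have Xw: "X k1 * w1 - X k2 * w2 \<in> periodic_ideal q m"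
    by (simp add: algebra_simps)
  have "q dvd (s1 - s2) + (r1 - r2) + \<omega> (v1 - v2) (X k1 * w1)
      + \<omega> v2 (X k1 * w1 - X k2 * w2)"
    by (intro dvd_add s r \<omega>_periodic_ideal[OF per] v Xw)
  then have "q dvd s1 + r1 + \<omega> v1 (X k1 * w1) - (s2 + r2 + \<omega> v2 (X k2 * w2))"
    by (simp add: \<omega>_diff algebra_simps)
  moreover have "v1 + X k1 * w1 - (v2 + X k2 * w2) \<in> periodic_ideal q m"
    using periodic_ideal_add[OF v Xw] by (simp add: algebra_simps)
  moreover have "m dvd k1 + l1 - (k2 + l2)"
    using dvd_add[OF k l] by (simp add: algebra_simps)
  ultimately show ?thesis by (simp add: H_mult)
qed

lemma H_cong_conj_by:
  assumes "period q m" "H_cong q m x y"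
  shows "H_cong q m (conj_by g x) (conj_by g y)"
  unfolding conj_by_def by (intro H_cong_mult assms H_cong_refl)

end

section \<open>Separating conjugacy classes of triples\<close>

lemma zero_if_dvd_of_smaller: "q dvd e \<Longrightarrow> \<bar>e\<bar> < q \<Longrightarrow> e = 0" for e q :: int
  using dvd_imp_le_int[of e q] by linarith

lemma zero_if_abs_Suc_dvd: "\<bar>e\<bar> + 1 dvd e \<Longrightarrow> e = 0" for e :: int
  by (erule zero_if_dvd_of_smaller) linarith

text \<open>If the exponents of \<open>v\<close> and \<open>v'\<close> lie between \<open>- B\<close> and \<open>B\<close>, then any \<open>l\<close> can be replaced modulo
  \<open>K = 4 B + 2\<close> by some \<open>l'\<close> for which the exponents of \<open>v'\<close> and those of \<open>v\<close> shifted by \<open>l'\<close>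
  share a window of length \<open>K\<close>: either
  \<open>0 \<le> l' \<le> 2 B + 1\<close> or \<open>- 2 B \<le> l' < 0\<close>. Within such a window, congruence modulo \<open>X\<^sup>K - 1\<close> is equality.\<close>

lemma separate_from_shifts:
  assumes "\<And>l. v' \<noteq> X l * v"
  obtains K where "K > 0" "\<And>l. \<not> X K - 1 dvd v' - X l * v"
proof -
  define B where "B = Max (insert 0 (abs ` (Poly_Mapping.keys v \<union> Poly_Mapping.keys v')))"
  have "\<bar>i\<bar> \<le> B" if "i \<in> Poly_Mapping.keys v \<union> Poly_Mapping.keys v'" for i
    unfolding B_def using that by (intro Max_ge) auto
  then have B: "- B \<le> i \<and> i \<le> B" if "i \<in> Poly_Mapping.keys v \<union> Poly_Mapping.keys v'" for i
    using that by (fastforce simp: abs_le_iff)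
  have B0: "B \<ge> 0"
    unfolding B_def by (intro Max_ge) auto
  define K where "K = 4 * B + 2"
  have no: False if "X K - 1 dvd v' - X l * v" for l
  proof -
    define c where "c = l mod K"
    define l' where "l' = (if c \<le> 2 * B + 1 then c else c - K)"
    \<comment> \<open>the left end of the common window\<close>
    define a where "a = (if c \<le> 2 * B + 1 then - B else - 3 * B)"
    have "K > 0" using B0 by (simp add: K_def)
    then have "0 \<le> c" "c < K" by (simp_all add: c_def)
    then have l': "a \<le> l' - B" "l' + B < a + K"
      and a: "a \<le> - B" "B < a + K"
      using B0 by (auto simp: l'_def a_def K_def)
    have "l - c = K * (l div K)" by (simp add: c_def minus_mod_eq_mult_div)
    then have "l - l' = K * (l div K + (if c \<le> 2 * B + 1 then 0 else 1))"
      by (simp add: l'_def distrib_left)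
    then have "X K - 1 dvd X l - X l'"
      by (intro X_minus_1_dvd_X_diff) simp
    then have "X K - 1 dvd (X l - X l') * v" by (rule dvd_mult2)
    from dvd_add[OF that this] have "X K - 1 dvd v' - X l' * v"
      by (simp add: algebra_simps)
    moreover have "Poly_Mapping.keys (v' - X l' * v) \<subseteq> {a..<a + K}"
    proof
      fix i assume "i \<in> Poly_Mapping.keys (v' - X l' * v)"
      then have "i \<in> Poly_Mapping.keys v' \<union> Poly_Mapping.keys (X l' * v)"
        by (rule subsetD[OF keys_diff])
      then consider "i \<in> Poly_Mapping.keys v'" | j where "j \<in> Poly_Mapping.keys v" "i = j + l'"
        by (auto simp: keys_X_mult)
      then show "i \<in> {a..<a + K}"
      proof cases
        case 1
        then show ?thesis using B[of i] a by simp
      next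
        case 2
        then show ?thesis using B[of j] l' by simp
      qed
    qed
    ultimately have "v' - X l' * v = 0" by (rule short_multiple_of_X_minus_1)
    then show False using assms[of l'] by simp
  qed
  show ?thesis
  proof (rule that)
    show "K > 0" using B0 by (simp add: K_def)
  qed (use no in blast)
qed

text \<open>Folding modulo \<open>K\<close> does not increase the sum of the absolute values of the coefficients, and
  shifting preserves it. So one \<open>q\<close> above the bound serves all shifts \<open>l\<close> at once: a folded
  difference divisible by \<open>q\<close> must be zero.\<close>

lemma separate_modulo_integer:
  assumes "\<And>l. \<not> X K - 1 dvd v' - X l * v"
  obtains q where "q > 0"
    "\<And>l m a. K dvd m \<Longrightarrow> v' - X l * v - (X K - 1) * a \<notin> periodic_ideal q m"
proof
  let ?q = "l1_norm v' + l1_norm v + 1"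
  show "?q > 0" using l1_norm_nonneg[of v] l1_norm_nonneg[of v'] by simp
  fix l m a
  assume Km: "K dvd m"
  show "v' - X l * v - (X K - 1) * a \<notin> periodic_ideal ?q m"
  proof
    assume mem: "v' - X l * v - (X K - 1) * a \<in> periodic_ideal ?q m"
    let ?f = "fold_mod K v' - fold_mod K (X l * v)"
    have 0: "fold_mod K ((X K - 1) * a) = 0" by (simp add: fold_mod_eq_0_iff)
    have "Poly_Mapping.lookup ?f i = 0" for i
    proof -
      have "?q dvd Poly_Mapping.lookup ?f i"
        using dvd_lookup_fold_mod[OF mem Km, of i] 0 by simp
      moreover have "\<bar>Poly_Mapping.lookup ?f i\<bar> < ?q"
        using lookup_fold_mod_le[of K v' i] lookup_fold_mod_le[of K "X l * v" i]
        by (simp add: lookup_minus)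
      ultimately show ?thesis by (rule zero_if_dvd_of_smaller)
    qed
    then have "fold_mod K (v' - X l * v) = 0"
      by (intro poly_mapping_eqI) simp
    then show False using assms fold_mod_eq_0_iff by blast
  qed
qed

context antisymmetric_sequence
begin

definition separated :: "laurent \<times> int \<times> int \<Rightarrow> laurent \<times> int \<times> int \<Rightarrow> bool" where
  "separated x y \<longleftrightarrow>
     (\<exists>q m. q > 0 \<and> m \<noteq> 0 \<and> period q m \<and> (\<forall>g. \<not> H_cong q m (conj_by g x) y))"

lemma separated_conj_by:
  assumes "separated (conj_by h x) y"
  shows "separated x y"
proof -
  have "conj_by g x = conj_by (g \<otimes>\<^bsub>H\<^esub> inv\<^bsub>H\<^esub> h) (conj_by h x)" for g
    by (simp add: conj_by_mult H.m_assoc)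
  then show ?thesis using assms unfolding separated_def by metis
qed

lemma separated_exponent:
  assumes "k \<noteq> k'"
  shows "separated (v, s, k) (v', s', k')"
proof -
  have "\<not> H_cong 1 (\<bar>k - k'\<bar> + 1) (conj_by g (v, s, k)) (v', s', k')" for g
  proof
    obtain w r l where g: "g = (w, r, l)" by (metis prod_cases3)
    assume "H_cong 1 (\<bar>k - k'\<bar> + 1) (conj_by g (v, s, k)) (v', s', k')"
    then have "\<bar>k - k'\<bar> + 1 dvd k - k'" by (simp add: g conj_by)
    then have "k - k' = 0" by (rule zero_if_abs_Suc_dvd)
    then show False using assms by simp
  qed
  then show ?thesis
    unfolding separated_def by (intro exI[of _ 1] exI[of _ "\<bar>k - k'\<bar> + 1"]) (simp add: period_def)
qed

text \<open>Conjugates of \<open>(v, s, k)\<close> have first components \<open>X\<^sup>l v + (1 - X\<^sup>k) w\<close>. For \<open>k \<noteq> 0\<close> these are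
  tested modulo \<open>K = k\<close>; for \<open>k = 0\<close> they are shifts of \<open>v\<close>, and \<open>K\<close> is chosen large.\<close>

lemma separated_coefficients:
  assumes per: "\<And>q. q > 0 \<Longrightarrow> \<exists>p\<ge>1. period q p"
    and no: "\<And>l w. v' \<noteq> X l * v + (1 - X k) * w"
  shows "separated (v, s, k) (v', s', k)"
proof -
  obtain K where K: "K \<noteq> 0" "k = 0 \<or> K = k" "\<And>l. \<not> X K - 1 dvd v' - X l * v"
  proof (cases "k = 0")
    case True
    then have "v' \<noteq> X l * v" for l using no[of l 0] by simp
    then show ?thesis using separate_from_shifts[of v' v] that True by (metis less_irrefl)
  next
    case False
    have "\<not> X k - 1 dvd v' - X l * v" for l
    proof
      assume "X k - 1 dvd v' - X l * v"
      then obtain w where "v' - X l * v = (X k - 1) * w" by (elim dvdE)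
      then have "v' = X l * v + (1 - X k) * (- w)" by (simp add: algebra_simps)
      then show False using no by blast
    qed
    then show ?thesis using that False by blast
  qed
  obtain q where q: "q > 0"
    "\<And>l m a. K dvd m \<Longrightarrow> v' - X l * v - (X K - 1) * a \<notin> periodic_ideal q m"
    using separate_modulo_integer[OF K(3)] by metis
  obtain p where p: "p \<ge> 1" "period q p" using per[OF q(1)] by blast
  have "\<not> H_cong q (p * K) (conj_by g (v, s, k)) (v', s', k)" for g
  proof
    obtain w r l where g: "g = (w, r, l)" by (metis prod_cases3)
    assume "H_cong q (p * K) (conj_by g (v, s, k)) (v', s', k)"
    then have "X l * v + (1 - X k) * w - v' \<in> periodic_ideal q (p * K)"
      by (simp add: g conj_by)
    from periodic_ideal_minus[OF this]
    have *: "v' - X l * v - (1 - X k) * w \<in> periodic_ideal q (p * K)"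
      by (simp add: algebra_simps)
    define a where "a = (if k = 0 then 0 else - w)"
    have "(X K - 1) * a = (1 - X k) * w"
      using K(2) by (auto simp: a_def algebra_simps)
    then show False using q(2)[of "p * K" l a] * by simp
  qed
  moreover have "period q (p * K)" by (rule period_mult[OF p(2)])
  ultimately show ?thesis
    unfolding separated_def using q(1) p(1) K(1)
    by (intro exI[of _ q] exI[of _ "p * K"]) simp
qed

text \<open>Conjugation by \<open>(w, r, l)\<close> adds \<open>2 \<omega> w (X\<^sup>l v)\<close> to \<open>s\<close>, and \<open>\<omega> w (X\<^sup>l v) = \<omega> (X\<^sup>-\<^sup>l w) v\<close>, so the
  reachable changes form the subgroup \<open>2 \<omega> (_, v)\<close> even when the quotient admits further \<open>l\<close>.
  Any nonzero member of that subgroup is a suitable modulus.\<close>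

lemma separated_base:
  assumes per: "\<And>q. q > 0 \<Longrightarrow> \<exists>p\<ge>1. period q p"
    and no: "\<And>g. conj_by g (v, s, 0) \<noteq> (v, s', 0)"
  shows "separated (v, s, 0) (v, s', 0)"
proof -
  have no': "s' \<noteq> s + 2 * \<omega> w v" for w
    using no[of "(w, 0, 0)"] \<omega>_swap[of w v] by (simp add: conj_by \<omega>_add)
  obtain q where q: "q > 0" and avoid: "\<And>w. \<not> q dvd s + 2 * \<omega> w v - s'"
  proof (cases "\<exists>w. \<omega> w v \<noteq> 0")
    case True
    then obtain w0 where w0: "\<omega> w0 v \<noteq> 0" by blast
    show ?thesis
    proof (rule that[of "\<bar>2 * \<omega> w0 v\<bar>"])
      fix w
      show "\<not> \<bar>2 * \<omega> w0 v\<bar> dvd s + 2 * \<omega> w v - s'"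
      proof
        assume "\<bar>2 * \<omega> w0 v\<bar> dvd s + 2 * \<omega> w v - s'"
        then obtain n where "s + 2 * \<omega> w v - s' = 2 * \<omega> w0 v * n"
          by (auto elim: dvdE)
        then have "s' = s + 2 * \<omega> (w - of_int n * w0) v"
          by (simp only: \<omega>_diff \<omega>_of_int_mult) (simp add: algebra_simps)
        then show False using no' by blast
      qed
    qed (use w0 in simp)
  next
    case False
    then have 0: "\<omega> w v = 0" for w by blast
    show ?thesis
    proof (rule that[of "\<bar>s - s'\<bar> + 1"])
      fix w
      show "\<not> \<bar>s - s'\<bar> + 1 dvd s + 2 * \<omega> w v - s'"
      proof
        assume "\<bar>s - s'\<bar> + 1 dvd s + 2 * \<omega> w v - s'"
        then have "s - s' = 0" by (intro zero_if_abs_Suc_dvd) (simp add: 0)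
        then show False using no'[of 0] by simp
      qed
    qed simp
  qed
  obtain p where p: "p \<ge> 1" "period q p" using per[OF q] by blast
  have "\<not> H_cong q p (conj_by g (v, s, 0)) (v, s', 0)" for g
  proof
    obtain w r l where g: "g = (w, r, l)" by (metis prod_cases3)
    assume "H_cong q p (conj_by g (v, s, 0)) (v, s', 0)"
    then have "q dvd s + 2 * \<omega> w (X l * v) - s'"
      using \<omega>_swap[of w "X l * v"] by (simp add: g conj_by \<omega>_add)
    moreover have "\<omega> w (X l * v) = \<omega> (X (- l) * w) v"
      using \<omega>_shift[of l "X (- l) * w" v] by simp
    ultimately show False using avoid by simp
  qed
  then show ?thesis
    unfolding separated_def using q p by (intro exI[of _ q] exI[of _ p]) simp
qed

lemma conj_by_central_shift:
  assumes "H_cong q m (conj_by g (v, s, k)) (v', s', k')"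
  shows "H_cong q m (conj_by g (v, s + e, k)) (v', s' + e, k')"
  using assms by (cases g) (simp add: conj_by algebra_simps)

text \<open>With last coordinate \<open>0\<close>, an element \<open>(w, r, 0)\<close> that fixes \<open>v\<close> modulo the ideal has
  \<open>(1 - X\<^sup>k) w\<close> in the ideal, and then \<open>s\<close> changes by \<open>2 \<omega> w v\<close> modulo \<open>q\<close>, which
  \<open>\<omega>_annihilator\<close> shows to be zero.\<close>

lemma H_cong_conj_by_central:
  assumes per: "period q p" and pos: "p \<ge> 1" "q \<ge> 1" and k: "k \<noteq> 0"
    and h: "H_cong q (k * p * q) (conj_by (w, r, 0) (v, s, k)) (v, s + e, k)"
  shows "q dvd e"
proof -
  let ?m = "k * p * q"
  have per': "period q ?m"
    using period_mult[OF per, of "k * q"] by (simp add: ac_simps)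
  define u where "u = (1 - X k) * w"
  have u: "u \<in> periodic_ideal q ?m"
    using h by (simp add: conj_by u_def)
  have Xw: "X k * w = w - u" by (simp add: u_def algebra_simps)
  have "q dvd \<omega> w v - \<omega> (w + v) (X k * w) - e"
    using h by (simp add: conj_by algebra_simps)
  moreover have "\<omega> w v - \<omega> (w + v) (X k * w) = 2 * \<omega> w v + \<omega> (w + v) u"
    using \<omega>_swap[of w v] by (simp add: Xw \<omega>_add \<omega>_diff)
  ultimately have "q dvd 2 * \<omega> w v + \<omega> (w + v) u - e" by simp
  moreover have "q dvd 2 * \<omega> w v + \<omega> (w + v) u"
    using \<omega>_annihilator[OF per pos k, of w v] u \<omega>_periodic_ideal(2)[OF per' u]
    by (simp add: u_def)
  ultimately show ?thesis using dvd_diff[of q "2 * \<omega> w v + \<omega> (w + v) u"] by fastforce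
qed

text \<open>If, up to congruence, conjugation by \<open>g\<close> adds \<open>e\<close> to the middle coordinate of \<open>x = (v, s, k)\<close>,
  then conjugation by \<open>g\<^sup>n x\<^sup>j\<close> adds \<open>n e\<close>,
  because \<open>x\<close> commutes with itself. The last coordinate of this product is \<open>l n + k j\<close>, which
  can be made zero by a choice of \<open>n\<close> and \<open>j\<close>.\<close>

lemma H_cong_conj_by_central_power:
  assumes per: "period q m"
    and g: "H_cong q m (conj_by (w, r, l) (v, s, k)) (v, s + e, k)"
  shows "\<exists>w r. H_cong q m (conj_by (w, r, l * int n + k * j) (v, s, k)) (v, s + int n * e, k)"
proof -
  let ?x = "(v, s, k)"
  have powers: "\<exists>w r. H_cong q m (conj_by (w, r, l * int n) ?x) (v, s + int n * e, k)"
  proof (induction n)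
    case 0
    have "H_cong q m (conj_by (0, 0, 0) ?x) (v, s, k)" by (simp add: conj_by)
    then show ?case by (metis add_0_right mult_zero_left mult_zero_right of_nat_0)
  next
    case (Suc n)
    then obtain w' r' where
      *: "H_cong q m (conj_by (w', r', l * int n) ?x) (v, s + int n * e, k)" by blast
    have "H_cong q m (conj_by (w, r, l) (conj_by (w', r', l * int n) ?x))
        (conj_by (w, r, l) (v, s + int n * e, k))"
      by (rule H_cong_conj_by[OF per *])
    moreover have "H_cong q m (conj_by (w, r, l) (v, s + int n * e, k)) (v, s + e + int n * e, k)"
      by (rule conj_by_central_shift[OF g])
    ultimately have "H_cong q m (conj_by ((w, r, l) \<otimes>\<^bsub>H\<^esub> (w', r', l * int n)) ?x)
        (v, s + e + int n * e, k)"
      unfolding conj_by_mult by (rule H_cong_trans)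
    then have "H_cong q m (conj_by (w + X l * w', r + r' + \<omega> w (X l * w'), l * int (Suc n)) ?x)
        (v, s + int (Suc n) * e, k)"
      by (simp add: H_mult algebra_simps)
    then show ?case by blast
  qed
  have fix_x: "conj_by ?x ?x = ?x" "conj_by (inv\<^bsub>H\<^esub> ?x) ?x = ?x"
    by (simp_all add: conj_by_def H.m_assoc)
  show ?thesis
  proof (induction j rule: int_induct[where k = 0])
    case base
    then show ?case using powers by simp
  next
    case (step1 j)
    then obtain w' r' where
      *: "H_cong q m (conj_by (w', r', l * int n + k * j) ?x) (v, s + int n * e, k)" by blast
    have "conj_by (w', r', l * int n + k * j) ?x
        = conj_by ((w', r', l * int n + k * j) \<otimes>\<^bsub>H\<^esub> ?x) ?x"
      by (simp only: conj_by_mult[symmetric] fix_x)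
    also have "\<exists>a b. (w', r', l * int n + k * j) \<otimes>\<^bsub>H\<^esub> ?x = (a, b, l * int n + k * (j + 1))"
      by (simp add: H_mult algebra_simps)
    then obtain a b where
      "(w', r', l * int n + k * j) \<otimes>\<^bsub>H\<^esub> ?x = (a, b, l * int n + k * (j + 1))" by blast
    finally show ?case using * by metis
  next
    case (step2 j)
    then obtain w' r' where
      *: "H_cong q m (conj_by (w', r', l * int n + k * j) ?x) (v, s + int n * e, k)" by blast
    have "conj_by (w', r', l * int n + k * j) ?x
        = conj_by ((w', r', l * int n + k * j) \<otimes>\<^bsub>H\<^esub> inv\<^bsub>H\<^esub> ?x) ?x"
      by (simp only: conj_by_mult[symmetric] fix_x)
    also have "\<exists>a b. (w', r', l * int n + k * j) \<otimes>\<^bsub>H\<^esub> inv\<^bsub>H\<^esub> ?x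
        = (a, b, l * int n + k * (j - 1))"
      by (simp add: H_mult H_inv right_diff_distrib)
    then obtain a b where "(w', r', l * int n + k * j) \<otimes>\<^bsub>H\<^esub> inv\<^bsub>H\<^esub> ?x
        = (a, b, l * int n + k * (j - 1))" by blast
    finally show ?case using * by metis
  qed
qed

text \<open>Taking \<open>n = \<bar>k\<bar>\<close> and \<open>j = \<plusminus> l\<close> in \<open>H_cong_conj_by_central_power\<close>, a conjugation in the quotient that changes
  \<open>s\<close> by \<open>e\<close> forces \<open>q\<close> to divide \<open>k e\<close>.\<close>

lemma separated_central:
  assumes per: "\<And>q. q > 0 \<Longrightarrow> \<exists>p\<ge>1. period q p"
    and "s \<noteq> s'" and k: "k \<noteq> 0"
  shows "separated (v, s, k) (v, s', k)"
proof -
  define e where "e = s' - s"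
  have s': "s' = s + e" and e: "e \<noteq> 0" using assms(2) by (simp_all add: e_def)
  define q where "q = \<bar>k\<bar> * (\<bar>e\<bar> + 1)"
  have q: "q > 0" using k by (simp add: q_def)
  obtain p where p: "p \<ge> 1" "period q p" using per[OF q] by blast
  have per': "period q (k * p * q)"
    using period_mult[OF p(2), of "k * q"] by (simp add: ac_simps)
  have "\<not> H_cong q (k * p * q) (conj_by g (v, s, k)) (v, s', k)" for g
  proof
    obtain w r l where g: "g = (w, r, l)" by (metis prod_cases3)
    assume "H_cong q (k * p * q) (conj_by g (v, s, k)) (v, s', k)"
    then have "H_cong q (k * p * q) (conj_by (w, r, l) (v, s, k)) (v, s + e, k)"
      by (simp only: g s')
    from H_cong_conj_by_central_power[OF per' this, of "nat \<bar>k\<bar>" "- (l * sgn k)"]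
    obtain w' r' where "H_cong q (k * p * q)
        (conj_by (w', r', l * \<bar>k\<bar> + k * - (l * sgn k)) (v, s, k)) (v, s + \<bar>k\<bar> * e, k)"
      by auto
    moreover have "l * \<bar>k\<bar> + k * - (l * sgn k) = 0"
      by (simp add: abs_sgn)
    ultimately have "H_cong q (k * p * q) (conj_by (w', r', 0) (v, s, k)) (v, s + \<bar>k\<bar> * e, k)"
      by (simp only:)
    then have "q dvd \<bar>k\<bar> * e"
      using H_cong_conj_by_central[OF p(2) p(1) _ k] q by simp
    then have "\<bar>e\<bar> + 1 dvd e" using k by (simp add: q_def)
    then have "e = 0" by (rule zero_if_abs_Suc_dvd)
    then show False using e by simp
  qed
  then show ?thesis
    unfolding separated_def using q p per' k
    by (intro exI[of _ q] exI[of _ "k * p * q"]) simp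
qed

lemma separated_if_not_conjugate:
  assumes per: "\<And>q. q > 0 \<Longrightarrow> \<exists>p\<ge>1. period q p"
    and no: "\<And>g. conj_by g x \<noteq> y"
  shows "separated x y"
proof -
  obtain v s k v' s' k' where xy: "x = (v, s, k)" "y = (v', s', k')" by (metis prod_cases3)
  consider "k \<noteq> k'" | "k = k'" "\<And>l w. v' \<noteq> X l * v + (1 - X k) * w"
    | l w where "k = k'" "v' = X l * v + (1 - X k) * w" by blast
  then show ?thesis
  proof cases
    case 1
    then show ?thesis unfolding xy by (rule separated_exponent)
  next
    case 2
    then show ?thesis unfolding xy using separated_coefficients[OF per 2(2)] by simp
  next
    case 3
    obtain s1 where x1: "conj_by (w, 0, l) x = (v', s1, k)"
      using 3 by (simp add: xy conj_by)
    have no1: "conj_by g (v', s1, k) \<noteq> (v', s', k)" for g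
      using no[of "g \<otimes>\<^bsub>H\<^esub> (w, 0, l)"] unfolding conj_by_mult[symmetric] x1
      by (simp add: xy(2) 3(1))
    have "separated (v', s1, k) (v', s', k)"
    proof (cases "k = 0")
      case True
      then show ?thesis using separated_base[OF per] no1 by simp
    next
      case False
      moreover have "s1 \<noteq> s'" using no1[of "\<one>\<^bsub>H\<^esub>"] by auto
      ultimately show ?thesis using separated_central[OF per] by blast
    qed
    then show ?thesis
      using separated_conj_by[of "(w, 0, l)" x y] x1 3 xy by simp
  qed
qed

end

section \<open>Evaluating words in groups\<close>

definition eval_letter :: "('a, 'b) monoid_scheme \<Rightarrow> ('g \<Rightarrow> 'a) \<Rightarrow> 'g \<times> bool \<Rightarrow> 'a" where
  "eval_letter K \<phi> l = (if snd l then \<phi> (fst l) else inv\<^bsub>K\<^esub> (\<phi> (fst l)))"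

fun eval_word :: "('a, 'b) monoid_scheme \<Rightarrow> ('g \<Rightarrow> 'a) \<Rightarrow> 'g gword \<Rightarrow> 'a" where
  "eval_word K \<phi> [] = \<one>\<^bsub>K\<^esub>"
| "eval_word K \<phi> (l # w) = eval_letter K \<phi> l \<otimes>\<^bsub>K\<^esub> eval_word K \<phi> w"

text \<open>The data for the universal property of a presentation: if the extension to words respects the
  relations, it factors through the presented group.\<close>

locale group_valuation = group K for K :: "('a, 'b) monoid_scheme" (structure) +
  fixes \<phi> :: "'g \<Rightarrow> 'a"
  assumes \<phi>_closed [simp]: "\<phi> x \<in> carrier K"
begin

lemma eval_letter_closed [simp]: "eval_letter K \<phi> l \<in> carrier K"
  by (simp add: eval_letter_def)

lemma eval_word_closed [simp]: "eval_word K \<phi> w \<in> carrier K"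
  by (induction w) simp_all

lemma eval_word_append: "eval_word K \<phi> (u @ v) = eval_word K \<phi> u \<otimes> eval_word K \<phi> v"
  by (induction u) (simp_all add: m_assoc)

lemma eval_gen_word [simp]: "eval_word K \<phi> (gen_word x) = \<phi> x"
  by (simp add: gen_word_def eval_letter_def)

lemma eval_inv_word: "eval_word K \<phi> (inv_word w) = inv (eval_word K \<phi> w)"
proof (induction w)
  case Nil
  then show ?case by (simp add: inv_word_def)
next
  case (Cons l w)
  have "inv_word (l # w) = inv_word w @ [(fst l, \<not> snd l)]"
    by (simp add: inv_word_def case_prod_beta)
  then show ?case
    using Cons by (simp add: eval_word_append eval_letter_def inv_mult_group)
qed

lemma eval_pow_word: "eval_word K \<phi> (pow_word w n) = eval_word K \<phi> w [^] n"
proof -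
  have *: "eval_word K \<phi> (concat (replicate i u)) = eval_word K \<phi> u [^] i" for u and i :: nat
    by (induction i) (simp_all add: eval_word_append group_commutes_pow[of "eval_word K \<phi> u" "eval_word K \<phi> u"])
  show ?thesis
    by (simp add: pow_word_def * eval_inv_word int_pow_inv int_pow_neg)
qed

lemma eval_comm_word: "eval_word K \<phi> (comm_word u v) =
    eval_word K \<phi> u \<otimes> eval_word K \<phi> v \<otimes> inv (eval_word K \<phi> u) \<otimes> inv (eval_word K \<phi> v)"
  by (simp add: comm_word_def eval_word_append eval_inv_word m_assoc)

lemma eval_word_equiv:
  assumes rel: "\<And>r s. (r, s) \<in> R \<Longrightarrow> eval_word K \<phi> r = eval_word K \<phi> s"
    and "word_equiv R u v"
  shows "eval_word K \<phi> u = eval_word K \<phi> v"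
  using assms(2)
proof induction
  case (cancel u x b v)
  have "eval_letter K \<phi> (x, b) \<otimes> (eval_letter K \<phi> (x, \<not> b) \<otimes> z) = z" if "z \<in> carrier K" for z
    using that by (cases b) (simp_all add: eval_letter_def flip: m_assoc)
  then show ?case by (simp add: eval_word_append)
qed (simp_all add: eval_word_append rel)

lemma presented_group_hom:
  assumes rel: "\<And>r s. (r, s) \<in> R \<Longrightarrow> eval_word K \<phi> r = eval_word K \<phi> s"
  obtains f where "f \<in> hom (presented_group R) K" "\<And>w. f (word_class R w) = eval_word K \<phi> w"
proof
  define f where "f = (\<lambda>A. eval_word K \<phi> (SOME w. A = word_class R w))"
  show f: "f (word_class R w) = eval_word K \<phi> w" for w
  proof -
    have "word_class R w = word_class R (SOME u. word_class R w = word_class R u)"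
      by (rule someI[of _ w]) simp
    then show ?thesis
      unfolding f_def word_class_eq_iff using eval_word_equiv[OF rel] by metis
  qed
  show "f \<in> hom (presented_group R) K"
  proof (rule homI)
    fix x y assume "x \<in> carrier (presented_group R)" "y \<in> carrier (presented_group R)"
    then obtain u v where "x = word_class R u" "y = word_class R v"
      by (auto simp: presented_group_def)
    then show "f (x \<otimes>\<^bsub>presented_group R\<^esub> y) = f x \<otimes> f y"
      by (simp add: presented_group_mult f eval_word_append)
  qed (auto simp: presented_group_def f)
qed

end

lemma word_class_in_carrier [simp]: "word_class R w \<in> carrier (presented_group R)"
  by (simp add: presented_group_def)

lemma group_valuation_generators:
  "group_valuation (presented_group R) (\<lambda>x. word_class R (gen_word x))"
  by (intro group_valuation.intro group_presented_group) (unfold_locales, simp)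

lemma word_class_eq_eval_word:
  "word_class R w = eval_word (presented_group R) (\<lambda>x. word_class R (gen_word x)) w"
proof (induction w)
  case Nil
  then show ?case by (simp add: presented_group_def)
next
  case (Cons l w)
  interpret group_valuation "presented_group R" "\<lambda>x. word_class R (gen_word x)"
    by (rule group_valuation_generators)
  have "word_class R [l] = eval_letter (presented_group R) (\<lambda>x. word_class R (gen_word x)) l"
  proof (cases "snd l")
    case True
    then show ?thesis by (simp add: eval_letter_def gen_word_def prod_eq_iff) (metis prod.collapse)
  next
    case False
    have "[l] = inv_word (gen_word (fst l))"
      using False by (cases l) (simp add: inv_word_def gen_word_def)
    moreover have "word_class R (inv_word u) = inv\<^bsub>presented_group R\<^esub> (word_class R u)" for u
    proof (rule inv_equality[symmetric])
      show "word_class R (inv_word u) \<otimes>\<^bsub>presented_group R\<^esub> word_class R u = \<one>\<^bsub>presented_group R\<^esub>"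
        using word_equiv_inv_left[of R u]
        by (simp add: presented_group_mult word_class_eq_iff[symmetric]) (simp add: presented_group_def)
    qed simp_all
    ultimately show ?thesis using False by (simp add: eval_letter_def)
  qed
  moreover have "word_class R (l # w) = word_class R [l] \<otimes>\<^bsub>presented_group R\<^esub> word_class R w"
    by (simp add: presented_group_mult)
  ultimately show ?case using Cons by simp
qed

lemma relation_in_presented_group: "(r, s) \<in> R \<Longrightarrow> word_class R r = word_class R s"
  using word_equiv.relation[of r s R "[]" "[]"] by (simp add: word_class_eq_iff)

section \<open>Normal forms\<close>

lemma (in group) inv_mult_cancel_left:
  assumes "x \<in> carrier G" "z \<in> carrier G"
  shows "inv x \<otimes> (x \<otimes> z) = z" "x \<otimes> (inv x \<otimes> z) = z"
  using assms by (simp_all flip: m_assoc)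

lemma (in group) commute_of_conjugate:
  assumes "x \<in> carrier G" "y \<in> carrier G" "x \<otimes> y \<otimes> inv x = z"
  shows "x \<otimes> y = z \<otimes> x"
  using assms by (auto simp: m_assoc)

lemma (in group) commute_inv:
  assumes "x \<in> carrier G" "y \<in> carrier G" "x \<otimes> y = y \<otimes> x"
  shows "inv x \<otimes> y = y \<otimes> inv x"
  using assms by (metis inv_closed inv_solve_left inv_solve_right m_assoc m_closed)

lemma (in group) commute_int_pow:
  assumes "x \<in> carrier G" "y \<in> carrier G" "x \<otimes> y = y \<otimes> x"
  shows "x [^] (n::int) \<otimes> y = y \<otimes> x [^] n"
proof -
  have nat: "x [^] (i::nat) \<otimes> y = y \<otimes> x [^] i" for i
    using assms group_commutes_pow by simp
  show ?thesis
  proof (cases n rule: int_cases2)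
    case (nonneg i)
    then show ?thesis using nat by (simp add: int_pow_int)
  next
    case (nonpos i)
    then show ?thesis using commute_inv[OF _ assms(2) nat] assms(1) by (simp add: int_pow_neg_int)
  qed
qed

text \<open>The consequences of the presentation that determine normal forms: the subgroup of powers of \<open>C\<close>
  is central, modulo it the \<open>A i\<close> commute, and \<open>T\<close> shifts them.\<close>

locale shifted_generators = group G for G :: "('a, 'b) monoid_scheme" (structure) +
  fixes A :: "int \<Rightarrow> 'a" and T C :: 'a and d :: "int \<Rightarrow> int"
  assumes A_closed [simp]: "A i \<in> carrier G"
    and T_closed [simp]: "T \<in> carrier G"
    and C_closed [simp]: "C \<in> carrier G"
    and T_A: "T \<otimes> A i = A (i + 1) \<otimes> T"
    and C_central: "x \<in> carrier G \<Longrightarrow> C \<otimes> x = x \<otimes> C"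
    and A_A: "A i \<otimes> A j = A j \<otimes> A i \<otimes> C [^] d (i - j)"
begin

sublocale A: group_valuation G A
  by unfold_locales simp

lemma C_pow_central: "x \<in> carrier G \<Longrightarrow> C [^] (n::int) \<otimes> x = x \<otimes> C [^] n"
  by (rule commute_int_pow) (simp_all add: C_central)

lemma C_pow_left_commute:
  "\<lbrakk>x \<in> carrier G; y \<in> carrier G\<rbrakk> \<Longrightarrow> C [^] (n::int) \<otimes> (x \<otimes> y) = x \<otimes> (C [^] n \<otimes> y)"
  by (simp add: C_pow_central[of x] flip: m_assoc)

definition commute_mod :: "'a \<Rightarrow> 'a \<Rightarrow> bool" where
  "commute_mod x y \<longleftrightarrow> (\<exists>n::int. x \<otimes> y = y \<otimes> x \<otimes> C [^] n)"

lemma commute_mod_sym: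
  assumes "x \<in> carrier G" "y \<in> carrier G" "commute_mod x y"
  shows "commute_mod y x"
proof -
  obtain n :: int where n: "x \<otimes> y = y \<otimes> x \<otimes> C [^] n"
    using assms(3) unfolding commute_mod_def by blast
  have "y \<otimes> x = x \<otimes> y \<otimes> C [^] (- n)"
    using assms(1,2) by (simp add: n m_assoc int_pow_neg)
  then show ?thesis unfolding commute_mod_def by blast
qed

lemma commute_mod_inv:
  assumes [simp]: "x \<in> carrier G" "y \<in> carrier G" and "commute_mod x y"
  shows "commute_mod (inv x) y"
proof -
  obtain n :: int where n: "y \<otimes> x = x \<otimes> y \<otimes> C [^] n"
    using commute_mod_sym assms unfolding commute_mod_def by blast
  have "inv x \<otimes> y = inv x \<otimes> (y \<otimes> x) \<otimes> inv x"
    by (simp add: m_assoc)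
  also have "\<dots> = inv x \<otimes> x \<otimes> y \<otimes> C [^] n \<otimes> inv x"
    by (simp only: n) (simp add: m_assoc inv_mult_cancel_left)
  also have "\<dots> = y \<otimes> inv x \<otimes> C [^] n"
    by (simp add: m_assoc C_pow_central[of "inv x"])
  finally show ?thesis unfolding commute_mod_def by blast
qed

lemma commute_mod_mult:
  assumes [simp]: "x \<in> carrier G" "y \<in> carrier G" "z \<in> carrier G"
    and "commute_mod x y" "commute_mod x z"
  shows "commute_mod x (y \<otimes> z)"
proof -
  obtain m n :: int where m: "x \<otimes> y = y \<otimes> x \<otimes> C [^] m" and n: "x \<otimes> z = z \<otimes> x \<otimes> C [^] n"
    using assms unfolding commute_mod_def by blast
  have "x \<otimes> (y \<otimes> z) = y \<otimes> x \<otimes> C [^] m \<otimes> z"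
    by (simp add: m flip: m_assoc)
  also have "\<dots> = y \<otimes> (x \<otimes> z) \<otimes> C [^] m"
    by (simp add: m_assoc C_pow_central[of z])
  also have "\<dots> = y \<otimes> z \<otimes> x \<otimes> C [^] (n + m)"
    by (simp add: n m_assoc int_pow_mult)
  finally show ?thesis unfolding commute_mod_def by blast
qed

lemma commute_mod_letters: "commute_mod (eval_letter G A l) (eval_letter G A l')"
proof -
  have A: "commute_mod (A i) (A j)" for i j
    using A_A unfolding commute_mod_def by blast
  have "commute_mod (eval_letter G A l) (A j)" for j
    using A commute_mod_inv by (simp add: eval_letter_def)
  then have "commute_mod (A j) (eval_letter G A l)" for j
    by (rule commute_mod_sym[rotated 2]) simp_all
  then have "commute_mod (eval_letter G A l') (eval_letter G A l)"
    using commute_mod_inv by (simp add: eval_letter_def[of G A l'])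
  then show ?thesis by (rule commute_mod_sym[rotated 2]) simp_all
qed

lemma commute_mod_letter_word: "commute_mod (eval_letter G A l) (eval_word G A w)"
proof (induction w)
  case Nil
  have "eval_letter G A l \<otimes> \<one> = \<one> \<otimes> eval_letter G A l \<otimes> C [^] (0::int)" by simp
  then show ?case unfolding commute_mod_def by (metis eval_word.simps(1))
qed (simp add: commute_mod_mult commute_mod_letters)

end

definition exponents :: "int gword \<Rightarrow> laurent" where
  "exponents u = (\<Sum>l\<leftarrow>u. if snd l then X (fst l) else - X (fst l))"

lemma exponents_simps [simp]:
  "exponents [] = 0"
  "exponents (l # u) = (if snd l then X (fst l) else - X (fst l)) + exponents u"
  "exponents (u @ v) = exponents u + exponents v"
  by (simp_all add: exponents_def)

lemma lookup_exponents_sign: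
  assumes "(i, \<not> b) \<notin> set u"
  shows "Poly_Mapping.lookup (exponents u) i * (if b then 1 else - 1) \<ge> 0"
  using assms by (induction u) (auto simp: lookup_add X_def)

context shifted_generators
begin

text \<open>In a word with vanishing exponents the first letter has an inverse partner further on. Moving the
  two together costs a power of the central element \<open>C\<close>, and cancelling them shortens the word.\<close>

lemma eval_word_exponents_0:
  "exponents u = 0 \<Longrightarrow> \<exists>n::int. eval_word G A u = C [^] n"
proof (induction u rule: length_induct)
  case (1 u)
  show ?case
  proof (cases u)
    case Nil
    then have "eval_word G A u = C [^] (0::int)" by simp
    then show ?thesis by blast
  next
    case (Cons l u')
    obtain i b where l: "l = (i, b)" by fastforce
    have "Poly_Mapping.lookup (exponents u) i = 0" using 1 by simp
    then have "Poly_Mapping.lookup (exponents u') i * (if b then 1 else - 1) < 0"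
      by (auto simp: Cons l lookup_add X_def split: if_splits)
    then have "(i, \<not> b) \<in> set u'" using lookup_exponents_sign[of i b u'] by fastforce
    then obtain p r where u': "u' = p @ (i, \<not> b) # r" by (meson split_list)
    let ?l = "eval_letter G A (i, b)"
    have inv_l: "eval_letter G A (i, \<not> b) = inv ?l" by (simp add: eval_letter_def)
    obtain n :: int where "?l \<otimes> eval_word G A p = eval_word G A p \<otimes> ?l \<otimes> C [^] n"
      using commute_mod_letter_word[of "(i, b)" p] unfolding commute_mod_def by blast
    then have "eval_word G A u = eval_word G A p \<otimes> ?l \<otimes> C [^] n \<otimes> inv ?l \<otimes> eval_word G A r"
      by (simp add: Cons l u' A.eval_word_append inv_l flip: m_assoc)
    also have "\<dots> = eval_word G A (p @ r) \<otimes> C [^] n"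
      by (simp add: A.eval_word_append m_assoc C_pow_left_commute inv_mult_cancel_left C_pow_central[of "eval_word G A r"])
    finally have eq: "eval_word G A u = eval_word G A (p @ r) \<otimes> C [^] n" .
    have "exponents (p @ r) = 0" "length (p @ r) < length u"
      using 1 by (auto simp: Cons l u' split: if_splits)
    then obtain m :: int where "eval_word G A (p @ r) = C [^] m" using 1 by blast
    then have "eval_word G A u = C [^] (m + n)" using eq by (simp add: int_pow_mult)
    then show ?thesis by blast
  qed
qed

lemma eval_word_shift:
  "T \<otimes> eval_word G A u = eval_word G A (map (\<lambda>(i, b). (i + 1, b)) u) \<otimes> T"
proof (induction u)
  case (Cons l u)
  obtain i b where l: "l = (i, b)" by fastforce
  have "T \<otimes> eval_letter G A l = eval_letter G A (i + 1, b) \<otimes> T"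
  proof (cases b)
    case True
    then show ?thesis by (simp add: l eval_letter_def T_A)
  next
    case False
    have "inv (A (i + 1)) \<otimes> T = inv (A (i + 1)) \<otimes> (T \<otimes> A i) \<otimes> inv (A i)"
      by (simp add: m_assoc)
    also have "\<dots> = T \<otimes> inv (A i)"
      unfolding T_A by (simp flip: m_assoc)
    finally show ?thesis using False by (simp add: l eval_letter_def)
  qed
  then have "T \<otimes> (eval_letter G A l \<otimes> eval_word G A u)
      = eval_letter G A (i + 1, b) \<otimes> (T \<otimes> eval_word G A u)"
    by (simp flip: m_assoc)
  then show ?case using Cons by (simp add: l m_assoc)
qed simp

lemma eval_word_unshift:
  "inv T \<otimes> eval_word G A u = eval_word G A (map (\<lambda>(i, b). (i - 1, b)) u) \<otimes> inv T"
proof -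
  let ?v = "map (\<lambda>(i, b). (i - 1, b)) u"
  have "map (\<lambda>(i, b). (i + 1, b)) ?v = u" by (induction u) auto
  then have eq: "T \<otimes> eval_word G A ?v = eval_word G A u \<otimes> T" using eval_word_shift[of ?v] by simp
  have "inv T \<otimes> eval_word G A u = inv T \<otimes> (eval_word G A u \<otimes> T) \<otimes> inv T"
    by (simp add: m_assoc)
  also have "\<dots> = eval_word G A ?v \<otimes> inv T"
    by (simp flip: eq) (simp flip: m_assoc)
  finally show ?thesis .
qed

lemma normal_form:
  fixes \<phi> :: "gen \<Rightarrow> 'a"
  assumes \<phi>: "\<phi> Gen_t = T" "\<And>i. \<phi> (Gen_a i) = A i" "\<And>i. \<phi> (Gen_c i) = C [^] d i"
  shows "\<exists>u (n::int) (k::int). eval_word G \<phi> w = eval_word G A u \<otimes> C [^] n \<otimes> T [^] k"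
proof (induction w)
  case Nil
  have "eval_word G \<phi> [] = eval_word G A [] \<otimes> C [^] (0::int) \<otimes> T [^] (0::int)" by simp
  then show ?case by blast
next
  case (Cons l w)
  then obtain u and n k :: int where
    IH: "eval_word G \<phi> w = eval_word G A u \<otimes> C [^] n \<otimes> T [^] k" by blast
  have shift: "\<exists>u (n::int) (k::int). z \<otimes> eval_word G \<phi> w = eval_word G A u \<otimes> C [^] n \<otimes> T [^] k"
    if z: "z = T [^] e" "z \<otimes> eval_word G A u = eval_word G A u' \<otimes> z" for z u' and e :: int
  proof -
    have [simp]: "z \<in> carrier G" by (simp add: z)
    have "z \<otimes> eval_word G \<phi> w = eval_word G A u' \<otimes> z \<otimes> C [^] n \<otimes> T [^] k"
      by (simp add: IH flip: m_assoc z(2))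
    also have "\<dots> = eval_word G A u' \<otimes> C [^] n \<otimes> (z \<otimes> T [^] k)"
      by (simp add: m_assoc C_pow_left_commute)
    also have "z \<otimes> T [^] k = T [^] (e + k)"
      by (simp add: z int_pow_mult)
    finally show ?thesis by blast
  qed
  obtain x b where l: "l = (x, b)" by fastforce
  show ?case
  proof (cases x)
    case Gen_t
    show ?thesis
    proof (cases b)
      case True
      then show ?thesis
        using shift[of T 1] eval_word_shift by (simp add: l Gen_t eval_letter_def \<phi>)
    next
      case False
      then show ?thesis
        using shift[of "inv T" "- 1"] eval_word_unshift
        by (simp add: l Gen_t eval_letter_def \<phi> int_pow_neg)
    qed
  next
    case (Gen_a i)
    have "eval_word G \<phi> (l # w) = eval_word G A ((i, b) # u) \<otimes> C [^] n \<otimes> T [^] k"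
      by (simp add: IH l Gen_a eval_letter_def \<phi> m_assoc)
    then show ?thesis by blast
  next
    case (Gen_c i)
    obtain m :: int where m: "eval_letter G \<phi> l = C [^] m"
    proof (cases b)
      case False
      then have "eval_letter G \<phi> l = C [^] (- d i)"
        by (simp add: l Gen_c eval_letter_def \<phi> int_pow_neg)
      then show ?thesis using that by blast
    qed (use that in \<open>simp add: l Gen_c eval_letter_def \<phi>\<close>)
    have "eval_word G \<phi> (l # w) = eval_word G A u \<otimes> (C [^] m \<otimes> C [^] n) \<otimes> T [^] k"
      by (simp add: IH m m_assoc C_pow_left_commute[of "eval_word G A u"])
    then show ?thesis by (metis C_closed int_pow_mult)
  qed
qed

end

section \<open>Conjugacy in factor groups\<close>

lemma (in normal) conjugate_in_FactGroupD:
  assumes "x \<in> carrier G" "y \<in> carrier G" "conjugate_in (G Mod H) (H #> x) (H #> y)"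
  obtains g where "g \<in> carrier G" "H #> y = H #> (g \<otimes> x \<otimes> inv g)"
proof -
  obtain g where "g \<in> carrier G" and
    "H #> y = (H #> g) <#> (H #> x) <#> inv\<^bsub>G Mod H\<^esub> (H #> g)"
    using assms(3) unfolding conjugate_in_def carrier_FactGroup by auto
  moreover have "inv\<^bsub>G Mod H\<^esub> (H #> g) = H #> inv g"
    using \<open>g \<in> carrier G\<close> by (simp add: inv_FactGroup carrier_FactGroup rcos_inv)
  ultimately show ?thesis using that assms(1) by (simp add: rcos_sum)
qed

lemma (in normal) conjugate_in_FactGroupI:
  assumes "x \<in> carrier G" "g \<in> carrier G" "H #> y = H #> (g \<otimes> x \<otimes> inv g)"
  shows "conjugate_in (G Mod H) (H #> x) (H #> y)"
proof -
  have "inv\<^bsub>G Mod H\<^esub> (H #> g) = H #> inv g"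
    using assms(2) by (simp add: inv_FactGroup carrier_FactGroup rcos_inv)
  then have "H #> y = (H #> g) <#> (H #> x) <#> inv\<^bsub>G Mod H\<^esub> (H #> g)"
    using assms by (simp add: rcos_sum)
  then show ?thesis
    using assms(2) unfolding conjugate_in_def carrier_FactGroup by auto
qed

section \<open>Embedding the presented group into the group of triples\<close>

context antisymmetric_sequence
begin

fun H_generator :: "gen \<Rightarrow> laurent \<times> int \<times> int" where
  "H_generator Gen_t = (0, 0, 1)"
| "H_generator (Gen_a i) = (X i, 0, 0)"
| "H_generator (Gen_c i) = (0, 2 * d i, 0)"

sublocale HG: group_valuation H H_generator
  by unfold_locales simp

lemma H_int_pow: "(v, s, 0) [^]\<^bsub>H\<^esub> n = (of_int n * v, n * s, 0)" for n :: int
proof -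
  have nat: "(v, s, 0) [^]\<^bsub>H\<^esub> i = (of_nat i * v, int i * s, 0)" for i :: nat
  proof (induction i)
    case (Suc i)
    have "\<omega> (of_nat i * v) v = 0"
      using \<omega>_of_int_mult[of "int i" v v] by simp
    with Suc show ?case by (simp add: H_mult algebra_simps)
  qed (simp add: H_one)
  show ?thesis
  proof (cases n rule: int_cases2)
    case (nonneg i)
    then show ?thesis using nat by (simp add: int_pow_int)
  next
    case (nonpos i)
    then show ?thesis using nat by (simp add: H.int_pow_neg_int H_inv)
  qed
qed

lemma H_relations:
  assumes "(r, s) \<in> G_relations d"
  shows "eval_word H H_generator r = eval_word H H_generator s"
proof -
  note evals = HG.eval_word_append HG.eval_inv_word HG.eval_pow_word HG.eval_comm_word
  have d_swap: "d (j - i) = - d (i - j)" for i j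
    using d_minus[of "i - j"] by simp
  from assms consider
      i where "r = t_word @ a_word i @ inv_word t_word" "s = a_word (i + 1)"
    | i where "r = t_word @ c_word i @ inv_word t_word" "s = c_word i"
    | i j where "r = comm_word (a_word i) (a_word j)" "s = c_word (i - j)"
    | i j where "r = comm_word (c_word i) (a_word j)" "s = []"
    | i j where "r = comm_word (c_word i) (c_word j)" "s = []"
    | i where "r = c_word i" "s = pow_word (c_word 1) (d i)"
    unfolding G_relations_def by blast
  then show ?thesis
  proof cases
    case 1
    then show ?thesis by (simp add: evals H_mult H_inv X_add[of i 1] mult.commute)
  next
    case 3
    then show ?thesis
      by (simp add: evals H_mult H_inv \<omega>_minus \<omega>_add \<omega>_X_X d_swap[of j i])
  qed (simp_all add: evals H_mult H_inv H_one H_int_pow d_1 \<omega>_minus)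
qed

text \<open>The two conditions determine this map on the carrier, because every element is the class of a word.\<close>

definition embed :: "gen gword set \<Rightarrow> laurent \<times> int \<times> int" where
  "embed = (SOME f. f \<in> hom (G_group d) H \<and>
        (\<forall>w. f (word_class (G_relations d) w) = eval_word H H_generator w))"

lemma embed: "embed \<in> hom (G_group d) H" "embed (word_class (G_relations d) w) = eval_word H H_generator w"
proof -
  obtain f where "f \<in> hom (G_group d) H"
    "\<And>w. f (word_class (G_relations d) w) = eval_word H H_generator w"
    using HG.presented_group_hom[OF H_relations] unfolding G_group_def by metis
  then have "\<exists>f. f \<in> hom (G_group d) H \<and>
        (\<forall>w. f (word_class (G_relations d) w) = eval_word H H_generator w)" by blast
  from someI_ex[OF this]
  show "embed \<in> hom (G_group d) H" "embed (word_class (G_relations d) w) = eval_word H H_generator w"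
    unfolding embed_def by blast+
qed

abbreviation (input) G where "G \<equiv> G_group d"
abbreviation (input) cls where "cls \<equiv> word_class (G_relations d)"
definition gen_elem :: "gen \<Rightarrow> gen gword set" where "gen_elem x = cls (gen_word x)"
abbreviation A where "A i \<equiv> gen_elem (Gen_a i)"
abbreviation T where "T \<equiv> gen_elem Gen_t"
abbreviation C where "C \<equiv> gen_elem (Gen_c 1)"

sublocale G: group_valuation "G_group d" gen_elem
  unfolding G_group_def gen_elem_def[abs_def] by (rule group_valuation_generators)

lemma cls_eq_eval: "cls w = eval_word G gen_elem w"
  unfolding G_group_def gen_elem_def[abs_def] by (rule word_class_eq_eval_word)

lemma carrier_G_cases:
  assumes "g \<in> carrier G"
  obtains w where "g = eval_word G gen_elem w"
proof -
  obtain w where "g = cls w" using assms by (auto simp: G_group_def presented_group_def)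
  then show ?thesis using that cls_eq_eval by simp
qed

lemma G_relation:
  assumes "(r, s) \<in> G_relations d"
  shows "eval_word G gen_elem r = eval_word G gen_elem s"
  using relation_in_presented_group[OF assms] by (simp only: cls_eq_eval)

lemma T_A_G: "T \<otimes>\<^bsub>G\<^esub> A i \<otimes>\<^bsub>G\<^esub> inv\<^bsub>G\<^esub> T = A (i + 1)"
proof -
  have "(t_word @ a_word i @ inv_word t_word, a_word (i + 1)) \<in> G_relations d"
    unfolding G_relations_def by blast
  from G_relation[OF this] show ?thesis
    by (simp add: G.eval_word_append G.eval_inv_word G.m_assoc)
qed

lemma T_c_G: "T \<otimes>\<^bsub>G\<^esub> gen_elem (Gen_c i) \<otimes>\<^bsub>G\<^esub> inv\<^bsub>G\<^esub> T = gen_elem (Gen_c i)"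
proof -
  have "(t_word @ c_word i @ inv_word t_word, c_word i) \<in> G_relations d"
    unfolding G_relations_def by blast
  from G_relation[OF this] show ?thesis
    by (simp add: G.eval_word_append G.eval_inv_word G.m_assoc)
qed

lemma c_G: "gen_elem (Gen_c i) = C [^]\<^bsub>G\<^esub> d i"
proof -
  have "(c_word i, pow_word (c_word 1) (d i)) \<in> G_relations d"
    unfolding G_relations_def by blast
  from G_relation[OF this] show ?thesis by (simp add: G.eval_pow_word)
qed

lemma A_A_G: "A i \<otimes>\<^bsub>G\<^esub> A j \<otimes>\<^bsub>G\<^esub> inv\<^bsub>G\<^esub> (A i) \<otimes>\<^bsub>G\<^esub> inv\<^bsub>G\<^esub> (A j) = C [^]\<^bsub>G\<^esub> d (i - j)"
proof -
  have "(comm_word (a_word i) (a_word j), c_word (i - j)) \<in> G_relations d"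
    unfolding G_relations_def by blast
  from G_relation[OF this] show ?thesis by (simp add: G.eval_comm_word c_G[of "i - j"])
qed

lemma C_commutes_generator: "C \<otimes>\<^bsub>G\<^esub> gen_elem x = gen_elem x \<otimes>\<^bsub>G\<^esub> C"
proof -
  have comm: "u \<otimes>\<^bsub>G\<^esub> v = v \<otimes>\<^bsub>G\<^esub> u"
    if "u \<in> carrier G" "v \<in> carrier G"
      "u \<otimes>\<^bsub>G\<^esub> v \<otimes>\<^bsub>G\<^esub> inv\<^bsub>G\<^esub> u \<otimes>\<^bsub>G\<^esub> inv\<^bsub>G\<^esub> v = \<one>\<^bsub>G\<^esub>" for u v
    using that by (metis G.inv_closed G.inv_equality G.inv_inv G.m_closed G.commute_of_conjugate)
  show ?thesis
  proof (cases x)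
    case Gen_t
    show ?thesis
      unfolding Gen_t using G.commute_of_conjugate[OF _ _ T_c_G[of 1]] by simp
  next
    case (Gen_a i)
    have "(comm_word (c_word 1) (a_word i), []) \<in> G_relations d"
      unfolding G_relations_def by blast
    from G_relation[OF this] show ?thesis
      unfolding Gen_a by (intro comm) (simp_all add: G.eval_comm_word)
  next
    case (Gen_c i)
    have "(comm_word (c_word 1) (c_word i), []) \<in> G_relations d"
      unfolding G_relations_def by blast
    from G_relation[OF this] show ?thesis
      unfolding Gen_c by (intro comm) (simp_all add: G.eval_comm_word)
  qed
qed

lemma C_central_G:
  assumes "g \<in> carrier G"
  shows "C \<otimes>\<^bsub>G\<^esub> g = g \<otimes>\<^bsub>G\<^esub> C"
proof -
  obtain w where g: "g = eval_word G gen_elem w" using carrier_G_cases assms by blast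
  show ?thesis
    unfolding g
  proof (induction w)
    case (Cons l w)
    have "gen_elem x \<otimes>\<^bsub>G\<^esub> C = C \<otimes>\<^bsub>G\<^esub> gen_elem x" for x
      by (simp add: C_commutes_generator)
    then have "eval_letter G gen_elem l \<otimes>\<^bsub>G\<^esub> C = C \<otimes>\<^bsub>G\<^esub> eval_letter G gen_elem l"
      by (simp add: eval_letter_def G.commute_inv)
    then have l: "C \<otimes>\<^bsub>G\<^esub> eval_letter G gen_elem l = eval_letter G gen_elem l \<otimes>\<^bsub>G\<^esub> C" by simp
    have "C \<otimes>\<^bsub>G\<^esub> (eval_letter G gen_elem l \<otimes>\<^bsub>G\<^esub> eval_word G gen_elem w)
        = eval_letter G gen_elem l \<otimes>\<^bsub>G\<^esub> (C \<otimes>\<^bsub>G\<^esub> eval_word G gen_elem w)"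
      by (simp add: l flip: G.m_assoc)
    then show ?case by (simp add: Cons G.m_assoc)
  qed simp
qed

sublocale SG: shifted_generators "G_group d" A T C d
proof (unfold_locales, goal_cases)
  case (4 i)
  show ?case using G.commute_of_conjugate[OF _ _ T_A_G] by simp
next
  case (5 x)
  then show ?case by (rule C_central_G)
next
  case (6 i j)
  have "A i \<otimes>\<^bsub>G\<^esub> A j = C [^]\<^bsub>G\<^esub> d (i - j) \<otimes>\<^bsub>G\<^esub> (A j \<otimes>\<^bsub>G\<^esub> A i)"
    unfolding A_A_G[symmetric] by (simp add: G.m_assoc G.inv_mult_cancel_left)
  also have "\<dots> = A j \<otimes>\<^bsub>G\<^esub> A i \<otimes>\<^bsub>G\<^esub> C [^]\<^bsub>G\<^esub> d (i - j)"
    by (rule G.commute_int_pow) (simp_all add: C_central_G)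
  finally show ?case .
qed simp_all

sublocale embed: group_hom "G_group d" H embed
  by (intro group_hom.intro group_hom_axioms.intro G.is_group H.is_group embed)

lemma embed_generator: "embed (gen_elem x) = H_generator x"
  by (simp add: gen_elem_def embed)

lemma embed_C_pow: "embed (C [^]\<^bsub>G\<^esub> (n::int)) = (0, 2 * n, 0)"
  by (simp add: embed.hom_int_pow embed_generator H_int_pow d_1 mult.commute)

lemma embed_T_pow: "embed (T [^]\<^bsub>G\<^esub> (n::int)) = (0, 0, n)"
proof -
  have nat: "(0, 0, 1) [^]\<^bsub>H\<^esub> i = (0, 0, int i)" for i :: nat
    by (induction i) (simp_all add: H_one H_mult)
  have "(0, 0, 1) [^]\<^bsub>H\<^esub> n = (0, 0, n)"
  proof (cases n rule: int_cases2)
    case (nonneg i)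
    then show ?thesis using nat by (simp add: int_pow_int)
  next
    case (nonpos i)
    then show ?thesis using nat by (simp add: H.int_pow_neg_int H_inv)
  qed
  then show ?thesis by (simp add: embed.hom_int_pow embed_generator)
qed

lemma embed_A_word: "\<exists>s. embed (eval_word G A u) = (exponents u, s, 0)"
proof (induction u)
  case Nil
  then show ?case by (simp add: H_one)
next
  case (Cons l u)
  then show ?case
    by (auto simp: eval_letter_def embed_generator H_mult H_inv)
qed

text \<open>The coordinates of the image of a normal form determine the exponents of the \<open>a\<^sub>i\<close> and of \<open>t\<close>. If they
  vanish, only a power of \<open>c\<close> is left, and its exponent is half the middle coordinate.\<close>

lemma inj_embed: "inj_on embed (carrier G)"
proof -
  have "g = \<one>\<^bsub>G\<^esub>" if g: "g \<in> carrier G" "embed g = \<one>\<^bsub>H\<^esub>" for g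
  proof -
    obtain w where "g = eval_word G gen_elem w" using carrier_G_cases g by blast
    then obtain u and n k :: int where
      nf: "g = eval_word G A u \<otimes>\<^bsub>G\<^esub> C [^]\<^bsub>G\<^esub> n \<otimes>\<^bsub>G\<^esub> T [^]\<^bsub>G\<^esub> k"
      using SG.normal_form[OF HOL.refl HOL.refl c_G, of w] by blast
    obtain s where s: "embed (eval_word G A u) = (exponents u, s, 0)" using embed_A_word by blast
    have "(exponents u, s + 2 * n, k) = (0, 0, 0)"
      using g by (simp add: nf s embed_C_pow embed_T_pow H_mult H_one)
    then have "exponents u = 0" and k: "k = 0" by simp_all
    then obtain m :: int where "eval_word G A u = C [^]\<^bsub>G\<^esub> m"
      using SG.eval_word_exponents_0 by blast
    then have g': "g = C [^]\<^bsub>G\<^esub> (m + n)" by (simp add: nf k G.int_pow_mult)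
    then have "m + n = 0" using g(2) by (simp add: embed_C_pow H_one)
    then show ?thesis by (simp add: g')
  qed
  then show ?thesis using embed.inj_on_one_iff by blast
qed

text \<open>The middle coordinate is not arbitrary, since the parity of \<open>r\<close> depends on \<open>v\<close>; but it does not affect
  conjugation.\<close>

lemma embed_onto_mod_centre:
  obtains g r where "g \<in> carrier G" "embed g = (v, r, k)"
proof -
  have "\<exists>g\<in>carrier G. \<exists>r. embed g = (v, r, 0)"
  proof (induction v rule: laurent_induct)
    case zero
    have "embed \<one>\<^bsub>G\<^esub> = (0, 0, 0)" by (simp add: H_one)
    then show ?case by (metis G.one_closed)
  next
    case (X i)
    have "embed (A i) = (X i, 0, 0)" by (simp add: embed_generator)
    then show ?case by (metis G.\<phi>_closed)
  next
    case (diff u w)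
    then obtain g h r s where "g \<in> carrier G" "h \<in> carrier G" "embed g = (u, r, 0)" "embed h = (w, s, 0)"
      by blast
    then have "embed (g \<otimes>\<^bsub>G\<^esub> inv\<^bsub>G\<^esub> h) = (u - w, r - s + \<omega> u (- w), 0)"
      by (simp add: H_inv H_mult)
    then show ?case using \<open>g \<in> carrier G\<close> \<open>h \<in> carrier G\<close> by (metis G.inv_closed G.m_closed)
  qed
  then obtain g r where "g \<in> carrier G" "embed g = (v, r, 0)" by blast
  then have "embed (g \<otimes>\<^bsub>G\<^esub> T [^]\<^bsub>G\<^esub> k) = (v, r, k)" by (simp add: embed_T_pow H_mult)
  then show ?thesis using that \<open>g \<in> carrier G\<close> by (meson G.int_pow_closed G.m_closed G.\<phi>_closed)
qed

lemma embed_conj: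
  assumes "g \<in> carrier G" "x \<in> carrier G"
  shows "embed (g \<otimes>\<^bsub>G\<^esub> x \<otimes>\<^bsub>G\<^esub> inv\<^bsub>G\<^esub> g) = conj_by (embed g) (embed x)"
  using assms by (simp add: conj_by_def)

section \<open>Periodicity implies conjugacy separability\<close>

text \<open>The first and last coordinates of a conjugating triple determine the result, so by
  \<open>embed_onto_mod_centre\<close> conjugacy of elements of the image can be tested in \<open>H\<close>. The finite
  quotients of \<open>H\<close> then restrict to \<open>G\<^sub>d\<close>.\<close>

lemma conjugacy_separable_if_periodic:
  assumes per: "\<And>q. q > 0 \<Longrightarrow> \<exists>p\<ge>1. period q p"
  shows "conjugacy_separable G"
  unfolding conjugacy_separable_def
proof (intro ballI impI)
  fix x y
  assume x: "x \<in> carrier G" and y: "y \<in> carrier G" and no: "\<not> conjugate_in G x y"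
  have "conj_by h (embed x) \<noteq> embed y" for h
  proof
    assume h: "conj_by h (embed x) = embed y"
    obtain w s k where [simp]: "h = (w, s, k)" by (metis prod_cases3)
    obtain g r where g: "g \<in> carrier G" "embed g = (w, r, k)" using embed_onto_mod_centre by blast
    have "embed (g \<otimes>\<^bsub>G\<^esub> x \<otimes>\<^bsub>G\<^esub> inv\<^bsub>G\<^esub> g) = embed y"
      using h x g by (cases "embed x") (simp add: embed_conj conj_by del: embed.hom_mult)
    then have "g \<otimes>\<^bsub>G\<^esub> x \<otimes>\<^bsub>G\<^esub> inv\<^bsub>G\<^esub> g = y"
      by (rule inj_onD[OF inj_embed]) (use x y g in simp_all)
    then show False using no g unfolding conjugate_in_def by blast
  qed
  then have "separated (embed x) (embed y)" using separated_if_not_conjugate[OF per] by blast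
  then obtain q m where q: "q > 0" and m: "m \<noteq> 0" and pm: "period q m"
    and sep: "\<And>g. \<not> H_cong q m (conj_by g (embed x)) (embed y)"
    unfolding separated_def by blast
  define N where "N = {g \<in> carrier G. H_cong q m (embed g) \<one>\<^bsub>H\<^esub>}"
  have cong1: "H_cong q m (u \<otimes>\<^bsub>H\<^esub> v) \<one>\<^bsub>H\<^esub>" if "H_cong q m u \<one>\<^bsub>H\<^esub>" "H_cong q m v \<one>\<^bsub>H\<^esub>" for u v
    using H_cong_mult[OF pm that] by simp
  have conj1: "H_cong q m (conj_by u v) \<one>\<^bsub>H\<^esub>" if "H_cong q m v \<one>\<^bsub>H\<^esub>" for u v
    using H_cong_conj_by[OF pm that, of u] by (simp add: conj_by_def)
  have inv1: "H_cong q m (inv\<^bsub>H\<^esub> u) \<one>\<^bsub>H\<^esub>" if "H_cong q m u \<one>\<^bsub>H\<^esub>" for u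
    using H_cong_mult[OF pm H_cong_refl[of q m "inv\<^bsub>H\<^esub> u"] that] by (simp add: H_cong_sym)
  have "subgroup N G"
    by (rule G.subgroupI) (auto simp: N_def cong1 inv1 intro!: exI[of _ "\<one>\<^bsub>G\<^esub>"])
  then have normal: "N \<lhd> G"
    unfolding G.normal_inv_iff by (auto simp: N_def embed_conj conj1 simp del: embed.hom_mult)
  interpret N: normal N "G_group d" by (rule normal)
  have H_cong_if_cosets_eq: "H_cong q m (embed u) (embed v)" if "u \<in> carrier G" "v \<in> carrier G"
    "N #>\<^bsub>G\<^esub> u = N #>\<^bsub>G\<^esub> v" for u v
  proof -
    have "u \<in> N #>\<^bsub>G\<^esub> v"
      using G.rcos_self[OF that(1) N.subgroup_axioms] that(3) by simp
    then obtain n where "n \<in> N" "u = n \<otimes>\<^bsub>G\<^esub> v" by (auto simp: r_coset_def)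
    then have n: "n \<in> carrier G" "H_cong q m (embed n) \<one>\<^bsub>H\<^esub>" unfolding N_def by blast+
    have "embed u = embed n \<otimes>\<^bsub>H\<^esub> embed v"
      unfolding \<open>u = n \<otimes>\<^bsub>G\<^esub> v\<close> by (rule embed.hom_mult[OF n(1) that(2)])
    then show ?thesis
      using H_cong_mult[OF pm n(2) H_cong_refl[of q m "embed v"]] by (simp only: H.l_one H_carrier)
  qed
  have cosets_eq_if_H_cong: "N #>\<^bsub>G\<^esub> u = N #>\<^bsub>G\<^esub> v" if "u \<in> carrier G" "v \<in> carrier G"
    "H_cong q m (embed u) (embed v)" for u v
  proof -
    have "H_cong q m (embed u \<otimes>\<^bsub>H\<^esub> inv\<^bsub>H\<^esub> embed v) \<one>\<^bsub>H\<^esub>"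
      using H_cong_mult[OF pm that(3) H_cong_refl, of "inv\<^bsub>H\<^esub> embed v"] by simp
    then have "u \<otimes>\<^bsub>G\<^esub> inv\<^bsub>G\<^esub> v \<in> N" using that unfolding N_def by simp
    then have "u \<in> N #>\<^bsub>G\<^esub> v" using N.rcos_module[OF G.is_group] that by blast
    then show ?thesis using G.repr_independence[OF _ _ N.subgroup_axioms] that(2) by simp
  qed
  have "finite (carrier (G Mod N))"
  proof -
    obtain R where R: "finite R" "\<And>v. \<exists>u\<in>R. v - u \<in> periodic_ideal q m"
      using finite_representatives_periodic_ideal[OF q m] by metis
    let ?R = "R \<times> {0..<q} \<times> {- \<bar>m\<bar>..\<bar>m\<bar>}"
    have rep: "\<exists>z\<in>?R. H_cong q m h z" for h
    proof -
      obtain v s k where h: "h = (v, s, k)" by (metis prod_cases3)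
      obtain u where u: "u \<in> R" "v - u \<in> periodic_ideal q m" using R by blast
      have "k mod m \<in> {- \<bar>m\<bar>..\<bar>m\<bar>}" using abs_mod_less[OF m, of k] by auto
      then have "(u, s mod q, k mod m) \<in> ?R" using u q by simp
      moreover have "H_cong q m h (u, s mod q, k mod m)"
        using u by (simp add: h minus_mod_eq_mult_div)
      ultimately show ?thesis by blast
    qed
    \<comment> \<open>each coset is recovered from the representative triple of any of its elements\<close>
    define \<rho> where "\<rho> = (\<lambda>z. N #>\<^bsub>G\<^esub> (SOME g. g \<in> carrier G \<and> H_cong q m (embed g) z))"
    have "carrier (G Mod N) \<subseteq> \<rho> ` ?R"
    proof
      fix K assume "K \<in> carrier (G Mod N)"
      then obtain g where g: "g \<in> carrier G" "K = N #>\<^bsub>G\<^esub> g" by (auto simp: carrier_FactGroup)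
      obtain z where z: "z \<in> ?R" "H_cong q m (embed g) z" using rep by blast
      define g' where "g' = (SOME g. g \<in> carrier G \<and> H_cong q m (embed g) z)"
      have "g' \<in> carrier G \<and> H_cong q m (embed g') z"
        unfolding g'_def by (rule someI[of _ g]) (use g z in simp)
      then have "N #>\<^bsub>G\<^esub> g = N #>\<^bsub>G\<^esub> g'"
        using g z H_cong_trans H_cong_sym by (intro cosets_eq_if_H_cong) blast+
      then have "K = \<rho> z" by (simp add: \<rho>_def g g'_def)
      then show "K \<in> \<rho> ` ?R" using z by blast
    qed
    moreover have "finite ?R" using R by simp
    ultimately show ?thesis by (meson finite_imageI finite_subset)
  qed
  moreover have "\<not> conjugate_in (G Mod N) (N #>\<^bsub>G\<^esub> x) (N #>\<^bsub>G\<^esub> y)"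
  proof
    assume "conjugate_in (G Mod N) (N #>\<^bsub>G\<^esub> x) (N #>\<^bsub>G\<^esub> y)"
    then obtain g where g: "g \<in> carrier G" "N #>\<^bsub>G\<^esub> y = N #>\<^bsub>G\<^esub> (g \<otimes>\<^bsub>G\<^esub> x \<otimes>\<^bsub>G\<^esub> inv\<^bsub>G\<^esub> g)"
      using N.conjugate_in_FactGroupD x y by blast
    then have "H_cong q m (embed y) (conj_by (embed g) (embed x))"
      using H_cong_if_cosets_eq[OF y _ g(2)] x by (simp add: embed_conj del: embed.hom_mult)
    then show False using sep H_cong_sym by blast
  qed
  ultimately show "\<exists>N. N \<lhd> G \<and> finite (carrier (G Mod N)) \<and>
      \<not> conjugate_in (G Mod N) (N #>\<^bsub>G\<^esub> x) (N #>\<^bsub>G\<^esub> y)"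
    using normal by blast
qed

end

section \<open>Conjugacy separability implies periodicity\<close>

context antisymmetric_sequence
begin

lemma A_shift: "T [^]\<^bsub>G\<^esub> i \<otimes>\<^bsub>G\<^esub> A n = A (n + int i) \<otimes>\<^bsub>G\<^esub> T [^]\<^bsub>G\<^esub> i" for i :: nat
proof (induction i arbitrary: n)
  case (Suc i)
  have "T [^]\<^bsub>G\<^esub> Suc i \<otimes>\<^bsub>G\<^esub> A n = T [^]\<^bsub>G\<^esub> i \<otimes>\<^bsub>G\<^esub> (T \<otimes>\<^bsub>G\<^esub> A n)"
    by (simp add: G.m_assoc)
  also have "\<dots> = T [^]\<^bsub>G\<^esub> i \<otimes>\<^bsub>G\<^esub> A (n + 1) \<otimes>\<^bsub>G\<^esub> T"
    by (simp add: SG.T_A G.m_assoc)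
  also have "\<dots> = A (n + 1 + int i) \<otimes>\<^bsub>G\<^esub> T [^]\<^bsub>G\<^esub> Suc i"
    by (simp add: Suc G.m_assoc)
  finally show ?case by (simp add: algebra_simps)
qed simp

text \<open>If \<open>t\<^sup>k\<close> dies in the quotient, then \<open>a\<^sub>n\<close> and \<open>a\<^sub>n\<^sub>+\<^sub>k\<close> become equal there, and hence so do their
  commutators with \<open>a\<^sub>0\<close>.\<close>

lemma period_of_order_in_quotient:
  assumes N: "N \<lhd> G" and fin: "finite (carrier (G Mod N))"
  obtains r k where "r > 0" "k \<ge> 1" "period r k" "\<And>n::int. C [^]\<^bsub>G\<^esub> n \<in> N \<longleftrightarrow> r dvd n"
proof -
  interpret N: normal N "G_group d" by (rule N)
  interpret Q: group "G Mod N" by (rule N.factorgroup_is_group)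
  have mem: "N #>\<^bsub>G\<^esub> g \<in> carrier (G Mod N)" if "g \<in> carrier G" for g
    using that by (simp add: carrier_FactGroup)
  have in_N: "g \<in> N \<longleftrightarrow> N #>\<^bsub>G\<^esub> g = \<one>\<^bsub>G Mod N\<^esub>" if "g \<in> carrier G" for g
    using that G.coset_join1[OF _ _ N.subgroup_axioms] G.coset_join2[OF _ N.subgroup_axioms]
      N.subset by auto
  define r where "r = Q.ord (N #>\<^bsub>G\<^esub> C)"
  have C_N: "C [^]\<^bsub>G\<^esub> n \<in> N \<longleftrightarrow> int r dvd n" for n :: int
    unfolding r_def using Q.int_pow_eq_id[OF mem, of C n]
    by (simp add: in_N N.FactGroup_int_pow del: one_FactGroup)
  have r: "r \<ge> 1" unfolding r_def by (rule Q.ord_ge_1[OF fin mem]) simp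
  define k where "k = Q.ord (N #>\<^bsub>G\<^esub> T)"
  have k: "k \<ge> 1" unfolding k_def by (rule Q.ord_ge_1[OF fin mem]) simp
  have "(N #>\<^bsub>G\<^esub> T) [^]\<^bsub>G Mod N\<^esub> k = \<one>\<^bsub>G Mod N\<^esub>"
    unfolding k_def by (rule Q.pow_ord_eq_1[OF mem]) simp
  then have T_k: "N #>\<^bsub>G\<^esub> (T [^]\<^bsub>G\<^esub> k) = \<one>\<^bsub>G Mod N\<^esub>"
    by (simp add: N.FactGroup_pow del: one_FactGroup)
  have coset_mult: "N #>\<^bsub>G\<^esub> (g \<otimes>\<^bsub>G\<^esub> h) = (N #>\<^bsub>G\<^esub> g) \<otimes>\<^bsub>G Mod N\<^esub> (N #>\<^bsub>G\<^esub> h)"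
    if "g \<in> carrier G" "h \<in> carrier G" for g h
    using that by (simp add: N.rcos_sum)
  have A_k: "N #>\<^bsub>G\<^esub> A (n + int k) = N #>\<^bsub>G\<^esub> A n" for n
  proof -
    have "(N #>\<^bsub>G\<^esub> (T [^]\<^bsub>G\<^esub> k)) \<otimes>\<^bsub>G Mod N\<^esub> (N #>\<^bsub>G\<^esub> A n)
        = (N #>\<^bsub>G\<^esub> A (n + int k)) \<otimes>\<^bsub>G Mod N\<^esub> (N #>\<^bsub>G\<^esub> (T [^]\<^bsub>G\<^esub> k))"
      by (simp add: A_shift flip: coset_mult del: mult_FactGroup)
    then show ?thesis
      using mem[of "A n"] mem[of "A (n + int k)"] unfolding T_k
      by (simp del: mult_FactGroup one_FactGroup)
  qed
  have "int r dvd d (n + int k) - d n" for n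
  proof -
    have com: "N #>\<^bsub>G\<^esub> (C [^]\<^bsub>G\<^esub> d n) = (N #>\<^bsub>G\<^esub> A n) \<otimes>\<^bsub>G Mod N\<^esub> (N #>\<^bsub>G\<^esub> A 0)
        \<otimes>\<^bsub>G Mod N\<^esub> inv\<^bsub>G Mod N\<^esub> (N #>\<^bsub>G\<^esub> A n) \<otimes>\<^bsub>G Mod N\<^esub> inv\<^bsub>G Mod N\<^esub> (N #>\<^bsub>G\<^esub> A 0)" for n
    proof -
      have inv: "inv\<^bsub>G Mod N\<^esub> (N #>\<^bsub>G\<^esub> A i) = N #>\<^bsub>G\<^esub> (inv\<^bsub>G\<^esub> A i)" for i
        by (simp add: N.inv_FactGroup mem N.rcos_inv)
      have "C [^]\<^bsub>G\<^esub> d n = A n \<otimes>\<^bsub>G\<^esub> A 0 \<otimes>\<^bsub>G\<^esub> inv\<^bsub>G\<^esub> A n \<otimes>\<^bsub>G\<^esub> inv\<^bsub>G\<^esub> A 0"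
        using A_A_G[of n 0] by simp
      then show ?thesis by (simp add: inv coset_mult del: mult_FactGroup)
    qed
    have "N #>\<^bsub>G\<^esub> (C [^]\<^bsub>G\<^esub> d (n + int k)) = N #>\<^bsub>G\<^esub> (C [^]\<^bsub>G\<^esub> d n)"
      unfolding com A_k ..
    then have "(N #>\<^bsub>G\<^esub> C) [^]\<^bsub>G Mod N\<^esub> d (n + int k) = (N #>\<^bsub>G\<^esub> C) [^]\<^bsub>G Mod N\<^esub> d n"
      by (simp add: N.FactGroup_int_pow)
    then show ?thesis
      unfolding r_def using Q.int_pow_eq[OF mem, of C] by (simp add: dvd_diff_commute)
  qed
  then have "period (int r) (int k)" by (simp add: period_def)
  then show ?thesis using that[of "int r" "int k"] r k C_N by simp
qed

lemma embed_A_pow: "embed (A i [^]\<^bsub>G\<^esub> (n::int)) = (of_int n * X i, 0, 0)"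
  by (simp add: embed.hom_int_pow embed_generator H_int_pow)

lemma conj_A_pow:
  "A 1 [^]\<^bsub>G\<^esub> n \<otimes>\<^bsub>G\<^esub> A 0 [^]\<^bsub>G\<^esub> q \<otimes>\<^bsub>G\<^esub> inv\<^bsub>G\<^esub> (A 1 [^]\<^bsub>G\<^esub> n)
    = A 0 [^]\<^bsub>G\<^esub> q \<otimes>\<^bsub>G\<^esub> C [^]\<^bsub>G\<^esub> (n * q)" for n q :: int
proof -
  have 1: "\<omega> (of_int n * X 1) (of_int q) = n * q"
    using \<omega>_swap[of "of_int n * X 1" "of_int q"] \<omega>_of_int_mult[of q 1 "of_int n * X 1"]
      \<omega>_of_int_mult[of n "X 1" 1] \<omega>_swap[of 1 "of_int n * X 1"] \<omega>_X_X[of 1 0] d_1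
    by simp
  have "embed (A 1 [^]\<^bsub>G\<^esub> n \<otimes>\<^bsub>G\<^esub> A 0 [^]\<^bsub>G\<^esub> q \<otimes>\<^bsub>G\<^esub> inv\<^bsub>G\<^esub> (A 1 [^]\<^bsub>G\<^esub> n))
      = embed (A 0 [^]\<^bsub>G\<^esub> q \<otimes>\<^bsub>G\<^esub> C [^]\<^bsub>G\<^esub> (n * q))"
    using 1 \<omega>_swap[of "of_int n * X 1" "of_int q"]
    by (subst embed_conj) (simp_all add: embed_A_pow embed_C_pow conj_by H_mult \<omega>_add)
  then show ?thesis by (rule inj_onD[OF inj_embed]) simp_all
qed

text \<open>A conjugation preserving \<open>a\<^sub>0\<^sup>q\<close> up to a central factor changes the middle coordinate by a value of
  \<open>2 \<omega> (_, q X\<^sup>l)\<close>, a multiple of \<open>2 q\<close>.\<close>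

lemma not_conjugate_A_pow:
  fixes m q :: int
  assumes "\<not> q dvd m"
  shows "\<not> conjugate_in G (A 0 [^]\<^bsub>G\<^esub> q) (A 0 [^]\<^bsub>G\<^esub> q \<otimes>\<^bsub>G\<^esub> C [^]\<^bsub>G\<^esub> m)"
proof
  assume "conjugate_in G (A 0 [^]\<^bsub>G\<^esub> q) (A 0 [^]\<^bsub>G\<^esub> q \<otimes>\<^bsub>G\<^esub> C [^]\<^bsub>G\<^esub> m)"
  then obtain g where "g \<in> carrier G"
    "A 0 [^]\<^bsub>G\<^esub> q \<otimes>\<^bsub>G\<^esub> C [^]\<^bsub>G\<^esub> m = g \<otimes>\<^bsub>G\<^esub> A 0 [^]\<^bsub>G\<^esub> q \<otimes>\<^bsub>G\<^esub> inv\<^bsub>G\<^esub> g"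
    unfolding conjugate_in_def by blast
  then have eq: "embed (A 0 [^]\<^bsub>G\<^esub> q \<otimes>\<^bsub>G\<^esub> C [^]\<^bsub>G\<^esub> m) = conj_by (embed g) (embed (A 0 [^]\<^bsub>G\<^esub> q))"
    by (simp add: embed_conj del: embed.hom_mult)
  obtain w r l where g: "embed g = (w, r, l)" by (metis prod_cases3)
  have "(of_int q * X 0, 2 * m, 0) = conj_by (w, r, l) (of_int q * X 0, 0, 0)"
    using eq by (simp add: g embed_A_pow embed_C_pow H_mult)
  then have "2 * m = \<omega> w (X l * of_int q) - \<omega> (X l * of_int q) w"
    by (simp add: conj_by \<omega>_add)
  also have "\<dots> = 2 * (q * - \<omega> (X l) w)"
    using \<omega>_swap[of w "X l * of_int q"] \<omega>_of_int_mult[of q "X l" w] by (simp add: mult.commute)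
  finally have "m = q * - \<omega> (X l) w" by simp
  then show False using assms by (metis dvd_triv_left)
qed

text \<open>If \<open>gcd r q\<close> divided \<open>m\<close>, then by Bezout \<open>c\<^sup>m\<close> would agree in the quotient with a power of
  \<open>c\<^sup>q\<close>, and conjugation by a power of \<open>a\<^sub>1\<close> multiplies \<open>a\<^sub>0\<^sup>q\<close> by any power of \<open>c\<^sup>q\<close>.\<close>

lemma period_improve:
  assumes sep: "conjugacy_separable G" and "q > 0" and m: "\<not> q dvd m"
  obtains e k where "e > 0" "e dvd q" "\<not> e dvd m" "k \<ge> 1" "period e k"
proof -
  let ?x = "A 0 [^]\<^bsub>G\<^esub> q" and ?y = "A 0 [^]\<^bsub>G\<^esub> q \<otimes>\<^bsub>G\<^esub> C [^]\<^bsub>G\<^esub> m"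
  have "?x \<in> carrier G" "?y \<in> carrier G" by simp_all
  then obtain N where N: "N \<lhd> G" "finite (carrier (G Mod N))"
    and no: "\<not> conjugate_in (G Mod N) (N #>\<^bsub>G\<^esub> ?x) (N #>\<^bsub>G\<^esub> ?y)"
    using sep not_conjugate_A_pow[OF m] unfolding conjugacy_separable_def by blast
  interpret N: normal N "G_group d" by (rule N(1))
  obtain r k where r: "r > 0" and k: "k \<ge> 1" "period r k"
    and C_N: "\<And>n::int. C [^]\<^bsub>G\<^esub> n \<in> N \<longleftrightarrow> r dvd n"
    using period_of_order_in_quotient[OF N] by metis
  have "\<not> gcd r q dvd m"
  proof
    assume "gcd r q dvd m"
    then obtain n where n: "m = gcd r q * n" by (elim dvdE)
    obtain a b where ab: "a * r + b * q = gcd r q" using bezout_int[of r q] by blast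
    have m_eq: "m = r * (a * n) + b * n * q"
      unfolding n ab[symmetric] by (simp add: algebra_simps)
    have "C [^]\<^bsub>G\<^esub> (r * (a * n)) \<in> N" by (simp add: C_N)
    moreover have "?y = C [^]\<^bsub>G\<^esub> (r * (a * n)) \<otimes>\<^bsub>G\<^esub> (?x \<otimes>\<^bsub>G\<^esub> C [^]\<^bsub>G\<^esub> (b * n * q))"
      unfolding m_eq by (simp add: G.int_pow_mult SG.C_pow_left_commute[of ?x])
    ultimately have "N #>\<^bsub>G\<^esub> ?y = N #>\<^bsub>G\<^esub> (?x \<otimes>\<^bsub>G\<^esub> C [^]\<^bsub>G\<^esub> (b * n * q))"
      using G.coset_join2[OF _ N.subgroup_axioms]
      by (simp add: N.subset flip: G.coset_mult_assoc)
    then have "N #>\<^bsub>G\<^esub> ?y = N #>\<^bsub>G\<^esub> (A 1 [^]\<^bsub>G\<^esub> (b * n) \<otimes>\<^bsub>G\<^esub> ?x \<otimes>\<^bsub>G\<^esub> inv\<^bsub>G\<^esub> (A 1 [^]\<^bsub>G\<^esub> (b * n)))"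
      by (simp only: conj_A_pow)
    then have "conjugate_in (G Mod N) (N #>\<^bsub>G\<^esub> ?x) (N #>\<^bsub>G\<^esub> ?y)"
      by (intro N.conjugate_in_FactGroupI[of ?x "A 1 [^]\<^bsub>G\<^esub> (b * n)"]) simp_all
    then show False using no by blast
  qed
  moreover have "period (gcd r q) k" using period_dvd[OF k(2)] by simp
  ultimately show ?thesis using that[of "gcd r q" k] k r by simp
qed

lemma periodic_if_conjugacy_separable:
  assumes sep: "conjugacy_separable G" and q: "q > 0"
  shows "\<exists>k\<ge>1. period q k"
proof -
  define S where "S = {m. m > 0 \<and> m dvd q \<and> (\<exists>k\<ge>1. period m k)}"
  have "S \<subseteq> {0..q}" using q by (auto simp: S_def zdvd_imp_le)
  then have fin: "finite S" by (rule finite_subset) simp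
  have "1 \<in> S" by (auto simp: S_def period_def)
  define m where "m = Max S"
  have "m \<in> S" unfolding m_def by (rule Max_in[OF fin]) (use \<open>1 \<in> S\<close> in blast)
  then obtain k where m: "m > 0" "m dvd q" and k: "k \<ge> 1" "period m k" by (auto simp: S_def)
  show ?thesis
  proof (cases "q dvd m")
    case True
    then have "m = q" using m q by (simp add: zdvd_antisym_nonneg)
    then show ?thesis using k by blast
  next
    case False
    obtain e l where e: "e > 0" "e dvd q" "\<not> e dvd m" "l \<ge> 1" "period e l"
      using period_improve[OF sep q False] by metis
    have "k * l \<ge> 1" using k e by (simp add: int_one_le_iff_zero_less)
    then have "lcm m e \<in> S"
      using m e period_lcm[OF k(2) e(5)] by (auto simp: S_def lcm_pos_int)
    then have "lcm m e \<le> m" unfolding m_def using fin by simp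
    moreover have "m \<le> lcm m e" using m e by (intro zdvd_imp_le) (simp_all add: lcm_pos_int)
    ultimately have "lcm m e = m" by simp
    then have "e dvd m" by (metis dvd_lcm2)
    then show ?thesis using e by blast
  qed
qed

end

theorem proposition4p3:
  fixes d :: "int \<Rightarrow> int"
  assumes "antisymmetric_fun d" and "d 1 = 1"
  shows "conjugacy_separable (G_group d) \<longleftrightarrow> (\<forall>q::int. q > 0 \<longrightarrow> periodic_mod d q)"
proof -
  interpret antisymmetric_sequence d
    by unfold_locales (use assms in \<open>simp_all add: antisymmetric_fun_def\<close>)
  have "periodic_mod d q \<longleftrightarrow> (\<exists>k\<ge>1. period q k)" for q
    by (simp add: periodic_mod_def period_def cong_iff_dvd_diff)
  then show ?thesis
    using conjugacy_separable_if_periodic periodic_if_conjugacy_separable by auto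
qed

end
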